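(* Let $(X,\mathcal U)$ be a Hausdorff uniform space whose topology is second countable and let $f\subset X\times X$ be a closed relation on $X$. There exists a totally bounded uniformity $\mathcal T\subset\mathcal U$, compatible with the topology of $X$, with completion $(\bar X,\bar{\mathcal T})$ of $(X,\mathcal T)$, such that $\bar X$ is a compact Hausdorff space and its unique uniformity $\bar{\mathcal T}$ is metrizable. Let $\bar f$ be the closure of $f$ in $\bar X\times\bar X$. The uniformity $\mathcal T$ can be chosen so that $$\bar f\cap(X\times X)=f,\qquad 1_X\cup\big(\mathcal G\bar f\cap(X\times X)\big)=1_X\cup\mathcal A_{\mathcal U}f,\qquad \mathcal C\bar f\cap(X\times X)=\mathcal C_{\mathcal U}f .$$ If $f$ is cusc (e.g. a continuous map), then $\mathcal G\bar f\cap(X\times X)=\mathcal A_{\mathcal U}f$. If $f$ is a uniformly continuous map then, in addition, $\mathcal T$ can be chosen so that $\bar f$ is a continuous map on $\bar X$. If $f$ is a uniform isomorphism then, in addition, $\mathcal T$ can be chosen so that $\bar f$ is a homeomorphism on $\bar X$.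
   Context: Spaces are nonempty. A relation on $X$ is a subset $f\subset X\times X$; $f(x)=\{y:(x,y)\in f\}$; a map is identified with its graph; $1_X$ is the diagonal. All pseudo-metrics are assumed bounded. For a uniformity $\mathcal U$ on $X$, its gage $\Gamma(\mathcal U)$ is the set of all bounded pseudo-metrics $d$ on $X$ with $\{(x,y):d(x,y)<\epsilon\}\in\mathcal U$ for every $\epsilon>0$. $\mathcal C_{\mathcal U}f$ is the set of pairs $(x,y)$ such that for every $d\in\Gamma(\mathcal U)$ and $\epsilon>0$ there are $n\ge1$ and $(a_1,b_1),\dots,(a_n,b_n)\in f$ with $\max(d(x,a_1),d(b_1,a_2),\dots,d(b_{n-1},a_n),d(b_n,y))<\epsilon$. $\mathcal A_{\mathcal U}f$ is the set of pairs $(x,y)$ such that for every $d\in\Gamma(\mathcal U)$ and $\epsilon>0$ there are $n\ge1$ and $(a_1,b_1),\dots,(a_n,b_n)\in f$ with $d(x,a_1)+\sum_{i=1}^{n-1}d(b_i,a_{i+1})+d(b_n,y)<\epsilon$. $\mathcal Gf$ is the smallest closed transitive relation containing $f$. On a compact Hausdorff space, $\mathcal Cf$ means $\mathcal C_{\mathcal U}f$ for the unique compatible uniformity. $f$ is cusc (compactly upper semicontinuous) if $f(x)$ is compact for every $x$ and $f^{-1}(B)=\{x:f(x)\cap B\ne\emptyset\}$ is closed for every closed $B$. A uniformity is totally bounded if for every $V$ in it the cover $\{V(x):x\in X\}$ has a finite subcover. The completion of $(X,\mathcal T)$ is the complete Hausdorff uniform space containing $(X,\mathcal T)$ as a dense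 uniform subspace. *)

theory Defs
  imports "HOL-Analysis.Analysis"
begin

text \<open>
  The space \<open>X\<close> of the theorem is a type of class \<^class>\<open>uniform_space\<close>. It carries a second,
  coarser uniformity, and the completion of the latter is a further uniform space, so uniformities
  are also needed as explicit objects on a carrier \<open>S\<close>. As in \<^class>\<open>uniform_space\<close>, a uniformity is
  the filter of its entourages. Note that \<open>V \<le> W\<close> for filters means that every entourage of
  \<open>W\<close> is one of \<open>V\<close>, so \<open>\<le>\<close> reverses the inclusion of uniformities.
\<close>

definition uniform_structure :: "'a set \<Rightarrow> ('a \<times> 'a) filter \<Rightarrow> bool" where
  "uniform_structure S V \<longleftrightarrow>
     V \<le> principal (S \<times> S) \<and>
     (\<forall>E. eventually E V \<longrightarrow> (\<forall>x\<in>S. E (x, x))) \<and>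
     (\<forall>E. eventually E V \<longrightarrow> eventually (\<lambda>(x, y). E (y, x)) V) \<and>
     (\<forall>E. eventually E V \<longrightarrow>
        (\<exists>D. eventually D V \<and> (\<forall>x\<in>S. \<forall>y\<in>S. \<forall>z\<in>S. D (x, y) \<longrightarrow> D (y, z) \<longrightarrow> E (x, z))))"

definition uniform_topology :: "'a set \<Rightarrow> ('a \<times> 'a) filter \<Rightarrow> 'a topology" where
  "uniform_topology S V =
     topology (\<lambda>A. A \<subseteq> S \<and> (\<forall>x\<in>A. eventually (\<lambda>(x', y). x' = x \<longrightarrow> y \<in> A) V))"

definition totally_bounded_structure :: "'a set \<Rightarrow> ('a \<times> 'a) filter \<Rightarrow> bool" where
  "totally_bounded_structure S V \<longleftrightarrow>
     (\<forall>E. eventually E V \<longrightarrow> (\<exists>F. finite F \<and> F \<subseteq> S \<and> (\<forall>y\<in>S. \<exists>x\<in>F. E (x, y))))"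

definition complete_structure :: "'a set \<Rightarrow> ('a \<times> 'a) filter \<Rightarrow> bool" where
  "complete_structure S V \<longleftrightarrow>
     (\<forall>F. F \<noteq> bot \<longrightarrow> F \<le> principal S \<longrightarrow> F \<times>\<^sub>F F \<le> V \<longrightarrow>
        (\<exists>x\<in>S. F \<le> nhdsin (uniform_topology S V) x))"

definition metrizable_structure :: "'a set \<Rightarrow> ('a \<times> 'a) filter \<Rightarrow> bool" where
  "metrizable_structure S V \<longleftrightarrow>
     (\<exists>d. Metric_space S d \<and>
        V = (INF e\<in>{0<..}. principal {(x, y). x \<in> S \<and> y \<in> S \<and> d x y < e}))"

text \<open>
  \<open>(Y, V)\<close> is the completion of the uniform space \<open>(UNIV, T)\<close>, which is regarded as a subspace of it
  through the embedding \<open>i\<close>; a relation \<open>R\<close> on \<open>Y\<close> meets \<open>X \<times> X\<close> in \<open>map_prod i i -` R\<close>. Completions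
  are unique up to isomorphism, and each one has a copy whose points are filters on \<open>X\<close>: a point is
  represented by the trace on \<open>X\<close> of its neighbourhood filter. So the type \<open>'a filter\<close> is large
  enough to hold the completion of any uniformity on \<open>'a\<close>.
\<close>

definition is_completion ::
    "('a \<times> 'a) filter \<Rightarrow> 'b set \<Rightarrow> ('b \<times> 'b) filter \<Rightarrow> ('a \<Rightarrow> 'b) \<Rightarrow> bool" where
  "is_completion T Y V i \<longleftrightarrow>
     uniform_structure Y V \<and>
     Hausdorff_space (uniform_topology Y V) \<and>
     complete_structure Y V \<and>
     inj i \<and> range i \<subseteq> Y \<and>
     T = filtercomap (map_prod i i) V \<and>
     uniform_topology Y V closure_of range i = Y"

definition bounded_pseudometric :: "'a set \<Rightarrow> ('a \<Rightarrow> 'a \<Rightarrow> real) \<Rightarrow> bool" where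
  "bounded_pseudometric S d \<longleftrightarrow>
     (\<forall>x\<in>S. d x x = 0) \<and>
     (\<forall>x\<in>S. \<forall>y\<in>S. 0 \<le> d x y \<and> d x y = d y x) \<and>
     (\<forall>x\<in>S. \<forall>y\<in>S. \<forall>z\<in>S. d x z \<le> d x y + d y z) \<and>
     (\<exists>B. \<forall>x\<in>S. \<forall>y\<in>S. d x y \<le> B)"

definition gage :: "'a set \<Rightarrow> ('a \<times> 'a) filter \<Rightarrow> ('a \<Rightarrow> 'a \<Rightarrow> real) set" where
  "gage S V =
     {d. bounded_pseudometric S d \<and> (\<forall>e>0. eventually (\<lambda>(x, y). d x y < e) V)}"

definition C_rel :: "'a set \<Rightarrow> ('a \<times> 'a) filter \<Rightarrow> ('a \<times> 'a) set \<Rightarrow> ('a \<times> 'a) set" where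
  "C_rel S V f = {(x, y). x \<in> S \<and> y \<in> S \<and>
     (\<forall>d\<in>gage S V. \<forall>e>0. \<exists>n\<ge>1. \<exists>a b. (\<forall>i\<in>{1..n}. (a i, b i) \<in> f) \<and>
        Max ({d x (a 1), d (b n) y} \<union> (\<lambda>i. d (b i) (a (Suc i))) ` {1..<n}) < e)}"

definition A_rel :: "'a set \<Rightarrow> ('a \<times> 'a) filter \<Rightarrow> ('a \<times> 'a) set \<Rightarrow> ('a \<times> 'a) set" where
  "A_rel S V f = {(x, y). x \<in> S \<and> y \<in> S \<and>
     (\<forall>d\<in>gage S V. \<forall>e>0. \<exists>n\<ge>1. \<exists>a b. (\<forall>i\<in>{1..n}. (a i, b i) \<in> f) \<and>
        d x (a 1) + (\<Sum>i = 1..<n. d (b i) (a (Suc i))) + d (b n) y < e)}"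

definition G_rel :: "'a topology \<Rightarrow> ('a \<times> 'a) set \<Rightarrow> ('a \<times> 'a) set" where
  "G_rel Z f = \<Inter>{R. closedin (prod_topology Z Z) R \<and> trans R \<and> f \<subseteq> R}"

definition cusc :: "('a::topological_space \<times> 'a) set \<Rightarrow> bool" where
  "cusc f \<longleftrightarrow> (\<forall>x. compact (f `` {x})) \<and> (\<forall>B. closed B \<longrightarrow> closed {x. f `` {x} \<inter> B \<noteq> {}})"

definition graph_on :: "'a set \<Rightarrow> ('a \<Rightarrow> 'a) \<Rightarrow> ('a \<times> 'a) set" where
  "graph_on S g = (\<lambda>x. (x, g x)) ` S"

definition uniformly_continuous_rel :: "('a::uniform_space \<times> 'a) set \<Rightarrow> bool" where
  "uniformly_continuous_rel f \<longleftrightarrow> (\<exists>g. f = graph_on UNIV g \<and> uniformly_continuous_on UNIV g)"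

definition uniform_isomorphism_rel :: "('a::uniform_space \<times> 'a) set \<Rightarrow> bool" where
  "uniform_isomorphism_rel f \<longleftrightarrow>
     (\<exists>g. f = graph_on UNIV g \<and> bij g \<and>
          uniformly_continuous_on UNIV g \<and> uniformly_continuous_on UNIV (inv g))"

definition continuous_rel_in :: "'a topology \<Rightarrow> ('a \<times> 'a) set \<Rightarrow> bool" where
  "continuous_rel_in Z f \<longleftrightarrow> (\<exists>h. f = graph_on (topspace Z) h \<and> continuous_map Z Z h)"

definition homeomorphism_rel_in :: "'a topology \<Rightarrow> ('a \<times> 'a) set \<Rightarrow> bool" where
  "homeomorphism_rel_in Z f \<longleftrightarrow> (\<exists>h. f = graph_on (topspace Z) h \<and> homeomorphic_map Z Z h)"

lemma openin_uniform_topology: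
  "openin (uniform_topology S V) A \<longleftrightarrow>
     A \<subseteq> S \<and> (\<forall>x\<in>A. eventually (\<lambda>(x', y). x' = x \<longrightarrow> y \<in> A) V)"
proof -
  have "istopology (\<lambda>A. A \<subseteq> S \<and> (\<forall>x\<in>A. eventually (\<lambda>(x', y). x' = x \<longrightarrow> y \<in> A) V))"
    unfolding istopology_def
  proof (intro conjI allI impI ballI)
    fix A B x
    assume "A \<subseteq> S \<and> (\<forall>x\<in>A. eventually (\<lambda>(x', y). x' = x \<longrightarrow> y \<in> A) V)"
      and "B \<subseteq> S \<and> (\<forall>x\<in>B. eventually (\<lambda>(x', y). x' = x \<longrightarrow> y \<in> B) V)"
      and "x \<in> A \<inter> B"
    then have "eventually (\<lambda>(x', y). x' = x \<longrightarrow> y \<in> A) V"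
      and "eventually (\<lambda>(x', y). x' = x \<longrightarrow> y \<in> B) V" by auto
    then show "eventually (\<lambda>(x', y). x' = x \<longrightarrow> y \<in> A \<inter> B) V"
      by eventually_elim auto
  next
    fix K x
    assume K: "\<forall>A\<in>K. A \<subseteq> S \<and> (\<forall>x\<in>A. eventually (\<lambda>(x', y). x' = x \<longrightarrow> y \<in> A) V)"
      and "x \<in> \<Union>K"
    then obtain A where "A \<in> K" "x \<in> A" by auto
    with K have "eventually (\<lambda>(x', y). x' = x \<longrightarrow> y \<in> A) V" by auto
    then show "eventually (\<lambda>(x', y). x' = x \<longrightarrow> y \<in> \<Union>K) V"
      by (rule eventually_mono) (use \<open>A \<in> K\<close> in auto)
  qed auto
  then show ?thesis
    by (simp add: uniform_topology_def topology_inverse')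
qed

lemma topspace_uniform_topology:
  assumes "uniform_structure S V"
  shows "topspace (uniform_topology S V) = S"
proof
  have "eventually (\<lambda>p. p \<in> S \<times> S) V"
    using assms by (simp add: uniform_structure_def le_principal)
  then have "eventually (\<lambda>(x', y). x' = x \<longrightarrow> y \<in> S) V" for x
    by (rule eventually_mono) auto
  then have "openin (uniform_topology S V) S"
    by (simp add: openin_uniform_topology)
  then show "S \<subseteq> topspace (uniform_topology S V)"
    by (rule openin_subset)
  show "topspace (uniform_topology S V) \<subseteq> S"
    using openin_topspace[of "uniform_topology S V"] unfolding openin_uniform_topology by blast
qed

lemma uniform_structure_uniformity: "uniform_structure UNIV (uniformity :: ('a::uniform_space \<times> 'a) filter)"
  unfolding uniform_structure_def
  using uniformity_refl uniformity_sym uniformity_trans by (auto; blast)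

lemma uniform_topology_uniformity:
  "uniform_topology UNIV (uniformity :: ('a::uniform_space \<times> 'a) filter) = euclidean"
  by (simp add: topology_eq openin_uniform_topology open_uniformity)

lemma cusc_graph:
  fixes g :: "'a::topological_space \<Rightarrow> 'a"
  assumes "continuous_on UNIV g"
  shows "cusc (graph_on UNIV g)"
proof -
  have "graph_on UNIV g `` {x} = {g x}" for x
    by (auto simp: graph_on_def)
  moreover have "{x. {g x} \<inter> B \<noteq> {}} = g -` B" for B
    by auto
  ultimately show ?thesis
    using assms by (auto simp: cusc_def continuous_on_closed_vimage)
qed

end

theory Submission
  imports Defs
begin

text \<open>
  All requirements on \<open>T\<close> are met as soon as \<open>T\<close> makes enough functions \<open>X \<rightarrow> [0,1]\<close> uniformly
  continuous, and countably many suffice. If \<open>(x, y)\<close> is not in \<open>A_rel UNIV uniformity f\<close>, then chain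
  lengths give uniformly continuous \<open>h \<le> j\<close> with \<open>j b \<le> h a\<close> on \<open>f\<close> and \<open>h x < j y\<close>; these
  inequalities extend to any compactification to which \<open>h\<close> and \<open>j\<close> extend and define there a closed
  transitive relation that contains the closure of \<open>f\<close> but not \<open>(x, y)\<close>. There is a similar pair for
  the chain relation. The pair works for all points near \<open>(x, y)\<close>, so by Lindelof countably many pairs
  serve all points, and closing the family under composition with \<open>f\<close> (and its inverse) makes \<open>f\<close>
  extend. The completion is the closure \<open>K\<close> of the image of \<open>X\<close> in the cube under these functions as
  coordinates. Conversely, \<open>A_rel\<close> is contained in \<open>G_rel\<close> on a compact space, diagonal included, by
  Nachbin's separation theorem for closed preorders.
\<close>

section \<open>Urysohn functions for quasi-uniformities\<close>

text \<open>Passing to a coarser uniformity shrinks the gage and can therefore enlarge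
  \<open>A_rel\<close> and \<open>C_rel\<close>; enough of the old gage must be kept to prevent
  this. A pseudo-metric of the old gage need not be totally bounded, and then it has no continuous
  extension to a compactification. What can be made to extend is a bounded function of one variable,
  so each failure of a chain condition is first condensed into two such functions. Their properties
  are closed conditions on finitely many coordinates and pass to the closure by density. The
  opposite inclusions are of another kind. Chains on \<open>X\<close> survive in the
  compactification, but there they have to be compared with an arbitrary closed transitive relation,
  for which no function is given in advance. The function has to be produced from the relation, and
  since the relation is not symmetric, this calls for a Urysohn lemma for non-symmetric filters. The
  same lemma yields the complete regularity of uniform spaces.\<close>

lemma quasi_uniform_Urysohn:
  fixes Q :: "('a \<times> 'a) filter"
  assumes refl: "\<And>E x. eventually E Q \<Longrightarrow> E (x, x)"
    and comp: "\<And>E. eventually E Q \<Longrightarrow>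
      \<exists>D. eventually D Q \<and> (\<forall>x y z. D (x, y) \<longrightarrow> D (y, z) \<longrightarrow> E (x, z))"
    and sep: "eventually (\<lambda>(x, y). x \<in> A \<longrightarrow> y \<in> B) Q"
  shows "\<exists>\<phi> :: 'a \<Rightarrow> real. range \<phi> \<subseteq> {0..1} \<and> (\<forall>x\<in>A. \<phi> x = 0) \<and> (\<forall>x. x \<notin> B \<longrightarrow> \<phi> x = 1) \<and>
    (\<forall>e>0. eventually (\<lambda>(x, y). \<phi> y \<le> \<phi> x + e) Q)"
proof -
  \<comment> \<open>Strong inclusion: an entourage of \<open>Q\<close> carries \<open>A\<close> into
    \<open>B\<close>. Splitting an entourage gives the interpolation \<open>R_between\<close>, which
    takes the place of normality in the dyadic construction.\<close>
  define R where "R \<equiv> \<lambda>A B. eventually (\<lambda>(x, y). x \<in> A \<longrightarrow> y \<in> B) Q"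
  have R_sub: "A \<subseteq> B" if AB: "R A B" for A B
    using refl[OF AB[unfolded R_def]] by auto
  have R_trans: "R A C" if "R A B" "R B C" for A B C
  proof -
    have "A \<subseteq> B" using that R_sub by blast
    then show ?thesis using that(2) unfolding R_def by (auto elim: eventually_mono)
  qed
  have R_between: "\<exists>C. R A C \<and> R C B" if AB: "R A B" for A B
  proof -
    obtain D where D: "eventually D Q"
      and DD: "\<And>x y z. D (x, y) \<Longrightarrow> D (y, z) \<Longrightarrow> x \<in> A \<Longrightarrow> z \<in> B"
      using comp[OF AB[unfolded R_def]] by auto
    define C where "C = {y. \<exists>x\<in>A. D (x, y)}"
    have "R A C" "R C B"
      unfolding R_def C_def by (rule eventually_mono[OF D]; use DD in auto)+
    then show ?thesis by blast
  qed
  have "\<exists>G::real \<Rightarrow> 'a set. G 0 = A \<and> G 1 = B \<and>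
          (\<forall>x \<in> dyadics \<inter> {0..1}. \<forall>y \<in> dyadics \<inter> {0..1}. x < y \<longrightarrow> R (G x) (G y))"
  proof (rule recursion_on_dyadic_fractions)
    show "R A B" using sep by (simp add: R_def)
  qed (use R_between R_trans in blast)+
  then obtain G :: "real \<Rightarrow> 'a set" where G0: "G 0 = A" and G1: "G 1 = B"
    and G: "\<And>x y. x \<in> dyadics \<Longrightarrow> y \<in> dyadics \<Longrightarrow> 0 \<le> x \<Longrightarrow> x < y \<Longrightarrow> y \<le> 1 \<Longrightarrow> R (G x) (G y)"
    by (metis (no_types, lifting) IntI atLeastAtMost_iff less_eq_real_def order_trans)
  \<comment> \<open>Inserting \<open>1\<close> gives points outside every level set the value
    \<open>1\<close> and keeps the infimum away from the empty set.\<close>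
  define S where "S x = insert 1 {r \<in> dyadics. 0 \<le> r \<and> r \<le> 1 \<and> x \<in> G r}" for x
  define \<phi> where "\<phi> x = Inf (S x)" for x
  have bdd: "bdd_below (S x)" for x
    unfolding S_def by (rule bdd_belowI[of _ 0]) auto
  have le: "\<phi> x \<le> r" if "r \<in> dyadics" "0 \<le> r" "r \<le> 1" "x \<in> G r" for x r
    unfolding \<phi>_def by (rule cInf_lower[OF _ bdd]) (use that in \<open>auto simp: S_def\<close>)
  have nonneg: "0 \<le> \<phi> x" for x
    unfolding \<phi>_def by (rule cInf_greatest) (auto simp: S_def)
  have le1: "\<phi> x \<le> 1" for x
    unfolding \<phi>_def by (rule cInf_lower[OF _ bdd]) (auto simp: S_def)
  have memG: "x \<in> G r" if "\<phi> x < r" "r \<in> dyadics" "r \<le> 1" for x r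
  proof -
    have "\<exists>s\<in>S x. s < r"
      using that(1) unfolding \<phi>_def by (subst (asm) cInf_less_iff[OF _ bdd]) (auto simp: S_def)
    then obtain s where s: "s \<in> S x" "s < r" by blast
    then have "s \<in> dyadics" "0 \<le> s" "x \<in> G s" using that by (auto simp: S_def)
    moreover have "R (G s) (G r)" using G calculation s that by blast
    ultimately show ?thesis using R_sub by blast
  qed
  show ?thesis
  proof (intro exI[of _ \<phi>] conjI ballI allI impI)
    show "range \<phi> \<subseteq> {0..1}" using nonneg le1 by auto
    show "\<phi> x = 0" if "x \<in> A" for x
      using le[of 0 x] nonneg[of x] that G0 real_in_dyadics[of 0] by auto
    show "\<phi> x = 1" if "x \<notin> B" for x
    proof -
      have "r = 1" if r: "r \<in> S x" for r
      proof (rule ccontr)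
        assume "r \<noteq> 1"
        then have "r \<in> dyadics" "0 \<le> r" "r < 1" "x \<in> G r" using r by (auto simp: S_def)
        then have "R (G r) (G 1)" using G[of r 1] real_in_dyadics[of 1] by auto
        then show False using R_sub \<open>x \<in> G r\<close> \<open>x \<notin> B\<close> G1 by blast
      qed
      then have "S x \<subseteq> {1}" by blast
      moreover have "1 \<in> S x" by (simp add: S_def)
      ultimately have "S x = {1}" by blast
      then show ?thesis by (simp add: \<phi>_def)
    qed
    show "eventually (\<lambda>(x, y). \<phi> y \<le> \<phi> x + e) Q" if epos: "e > 0" for e
    proof -
      \<comment> \<open>Two mesh widths are lost: one in rounding \<open>\<phi> x\<close> up to a
        grid point, one in passing to the next level set.\<close>
      obtain n where "(1/2) ^ n < e / 2"
        using real_arch_pow_inv[of "e/2" "1/2"] epos by auto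
      then have n: "2 / 2 ^ n < e" by (simp add: power_one_over field_simps)
      define t :: "nat \<Rightarrow> real" where "t k = real k / 2 ^ n" for k
      have t: "t k \<in> dyadics" for k unfolding t_def dyadics_def by auto
      have "eventually (\<lambda>p. \<forall>k\<in>{..<2^n}. fst p \<in> G (t k) \<longrightarrow> snd p \<in> G (t (Suc k))) Q"
      proof (rule eventually_ball_finite, simp, rule ballI)
        fix k :: nat assume "k \<in> {..<2^n}"
        then have "Suc k \<le> 2^n" by simp
        then have "real (Suc k) \<le> 2^n" by (metis of_nat_le_iff of_nat_numeral of_nat_power)
        then have "R (G (t k)) (G (t (Suc k)))"
          by (intro G t) (auto simp: t_def field_simps)
        then show "eventually (\<lambda>p. fst p \<in> G (t k) \<longrightarrow> snd p \<in> G (t (Suc k))) Q"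
          by (simp add: R_def case_prod_beta')
      qed
      then show ?thesis
      proof eventually_elim
        case (elim p)
        obtain x y where p: "p = (x, y)" by fastforce
        have "\<phi> y \<le> \<phi> x + e"
        proof -
          \<comment> \<open>The \<open>+ 1\<close> makes \<open>t k\<close> strictly larger than
            \<open>\<phi> x\<close>: the infimum need not be attained, so only a strict bound puts
            \<open>x\<close> into a level set. Once \<open>t k\<close> reaches \<open>1\<close>, the
            estimate is trivial.\<close>
          define k where "k = nat \<lfloor>\<phi> x * 2 ^ n\<rfloor> + 1"
          have k: "\<phi> x < t k" "t (Suc k) \<le> \<phi> x + 2 / 2 ^ n"
          proof -
            have f: "real k = of_int \<lfloor>\<phi> x * 2 ^ n\<rfloor> + 1"
              using nonneg[of x] by (simp add: k_def)
            have "\<phi> x * 2 ^ n < real k" "real k \<le> \<phi> x * 2 ^ n + 1" unfolding f by linarith+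
            moreover from this have "t (Suc k) \<le> (\<phi> x * 2 ^ n + 2) / 2 ^ n"
              unfolding t_def by (intro divide_right_mono) auto
            ultimately show "\<phi> x < t k" "t (Suc k) \<le> \<phi> x + 2 / 2 ^ n"
              by (simp_all add: t_def pos_less_divide_eq add_divide_distrib)
          qed
          show ?thesis
          proof (cases "k < 2 ^ n")
            case True
            then have kn: "real (Suc k) \<le> 2^n"
              by (metis Suc_leI of_nat_le_iff of_nat_numeral of_nat_power)
            then have t1: "t k \<le> 1" "t (Suc k) \<le> 1" using True by (auto simp: t_def)
            then have "x \<in> G (t k)" using memG k t by blast
            then have "y \<in> G (t (Suc k))" using elim True p by auto
            then have "\<phi> y \<le> t (Suc k)" using le[OF t _ t1(2)] by (simp add: t_def)
            then show ?thesis using k n by linarith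
          next
            case False
            then have "(2::real)^n \<le> real k" by (metis not_less of_nat_le_iff of_nat_numeral of_nat_power)
            then have "1 \<le> t k" by (simp add: t_def field_simps)
            moreover have "t k \<le> t (Suc k)" by (simp add: t_def divide_right_mono)
            ultimately show ?thesis using le1[of y] k n by linarith
          qed
        qed
        then show ?case using p by simp
      qed
    qed
  qed
qed

section \<open>Closed preorders on compact metric spaces\<close>

definition near :: "('m::metric_space \<times> 'm) set \<Rightarrow> real \<Rightarrow> ('m \<times> 'm) set" where
  "near R e = {(x, y). \<exists>x' y'. (x', y') \<in> R \<and> dist x x' < e \<and> dist y y' < e}"

lemma near_mono: "e \<le> e' \<Longrightarrow> near R e \<subseteq> near R e'"
  unfolding near_def by fastforce

text \<open>The shrinking thickenings supply points of \<open>R\<close> at vanishing distance, hence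
  with the same limits. The compactness arguments for preorders negate a uniform statement, take bad
  points for each \<open>1/(n+1)\<close> and close with this lemma.\<close>

lemma near_seq_limit:
  fixes R :: "('m::metric_space \<times> 'm) set"
  assumes "closed R" "\<And>n. (x n, y n) \<in> near R (inverse (real (Suc n)))" "strict_mono r"
    "(x \<circ> r) \<longlonglongrightarrow> l" "(y \<circ> r) \<longlonglongrightarrow> m"
  shows "(l, m) \<in> R"
proof -
  have "\<forall>n. \<exists>p. p \<in> R \<and> dist (x n) (fst p) < inverse (real (Suc n)) \<and>
      dist (y n) (snd p) < inverse (real (Suc n))"
    using assms(2) unfolding near_def by force
  from choice[OF this] obtain g where g: "\<forall>n. g n \<in> R \<and>
      dist (x n) (fst (g n)) < inverse (real (Suc n)) \<and> dist (y n) (snd (g n)) < inverse (real (Suc n))" ..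
  define x' y' where "x' n = fst (g n)" and "y' n = snd (g n)" for n
  have xy: "\<And>n. (x' n, y' n) \<in> R" "\<And>n. dist (x n) (x' n) < inverse (real (Suc n))"
    "\<And>n. dist (y n) (y' n) < inverse (real (Suc n))"
    using g by (auto simp: x'_def y'_def)
  have z: "(\<lambda>n. inverse (real (Suc (r n)))) \<longlonglongrightarrow> 0"
    using LIMSEQ_subseq_LIMSEQ[OF LIMSEQ_inverse_real_of_nat assms(3)] by (simp add: o_def)
  have lim: "(u' \<circ> r) \<longlonglongrightarrow> l" if "\<And>n. dist (u n) (u' n) < inverse (real (Suc n))" "(u \<circ> r) \<longlonglongrightarrow> l"
    for u u' :: "nat \<Rightarrow> 'm" and l
  proof -
    have "(\<lambda>n. dist ((u \<circ> r) n) l + inverse (real (Suc (r n)))) \<longlonglongrightarrow> 0 + 0"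
      using that(2) z tendsto_dist_iff by (intro tendsto_add) blast+
    then have "(\<lambda>n. dist ((u' \<circ> r) n) l) \<longlonglongrightarrow> 0"
    proof (rule metric_tendsto_imp_tendsto, intro always_eventually allI)
      fix n
      have "dist (u' (r n)) l \<le> dist (u (r n)) l + dist (u (r n)) (u' (r n))"
        by (metis add.commute dist_commute dist_triangle)
      then show "dist (dist ((u' \<circ> r) n) l) 0 \<le> dist (dist ((u \<circ> r) n) l + inverse (real (Suc (r n)))) (0 + 0)"
        using that(1)[of "r n"] by simp
    qed
    then show ?thesis using tendsto_dist_iff by blast
  qed
  have "(\<lambda>n. ((x' \<circ> r) n, (y' \<circ> r) n)) \<longlonglongrightarrow> (l, m)"
    using lim[OF xy(2) assms(4)] lim[OF xy(3) assms(5)] by (rule tendsto_Pair)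
  moreover have "\<And>n. ((x' \<circ> r) n, (y' \<circ> r) n) \<in> R" using xy(1) by simp
  ultimately show ?thesis
    using closed_sequentially[OF assms(1), of "\<lambda>n. ((x' \<circ> r) n, (y' \<circ> r) n)" "(l, m)"] by blast
qed

text \<open>
  A compact form of Nachbin's theorem: the neighbourhoods of a closed preorder on a compact space are
  the entourages of a quasi-uniformity, and a function that is quasi-uniformly continuous for it is
  monotone because the preorder lies in every entourage, and continuous because the diagonal does.
  Separating \<open>y\<close> from \<open>G `` {x}\<close> instead of from \<open>x\<close> covers the case \<open>x = y\<close> as well.
\<close>

lemma compact_preorder_separation:
  fixes K :: "'m::metric_space set"
  assumes K: "compact K" and G: "closed G" "G \<subseteq> K \<times> K" "trans G" and xy: "x \<in> K" "y \<in> K" "(x, y) \<notin> G"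
  obtains L :: "'m \<Rightarrow> real" and \<delta> where "\<And>p. L p \<in> {0..1}"
    "\<And>e. e > 0 \<Longrightarrow> \<exists>\<eta>>0. \<forall>p\<in>K. \<forall>q\<in>K. dist p q < \<eta> \<longrightarrow> \<bar>L p - L q\<bar> < e"
    "\<And>p q. (p, q) \<in> G \<Longrightarrow> L q \<le> L p" "L y = 1"
    "\<delta> > 0" "\<And>p q. (p, q) \<in> G \<Longrightarrow> dist x p < \<delta> \<Longrightarrow> L q < 1/2"
proof -
  define R where "R = G \<union> (\<lambda>p. (p, p)) ` K"
  have R_sub: "R \<subseteq> K \<times> K" using G by (auto simp: R_def)
  have R_refl: "(p, p) \<in> R" if "p \<in> K" for p using that by (auto simp: R_def)
  have R_trans: "(p, r) \<in> R" if "(p, q) \<in> R" "(q, r) \<in> R" for p q r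
    using that transD[OF G(3)] by (auto simp: R_def)
  have "compact ((\<lambda>p. (p, p)) ` K)"
    by (intro compact_continuous_image K continuous_intros)
  then have R_closed: "closed R" unfolding R_def using G(1) compact_imp_closed by blast
  \<comment> \<open>The diagonal of the whole type is added because the Urysohn lemma demands
    reflexivity at every point, whereas \<open>R\<close> is reflexive only on
    \<open>K\<close>.\<close>
  define N where "N e = {(p, q). p \<in> K \<and> q \<in> K \<and> (p, q) \<in> near R e} \<union> Id" for e
  define Q where "Q = (INF e\<in>{0<..}. principal (N e))"
  have N_mono: "N e \<subseteq> N e'" if "e \<le> e'" for e e'
    using near_mono[OF that, of R] by (auto simp: N_def)
  have evQ: "eventually P Q \<longleftrightarrow> (\<exists>e>0. \<forall>p\<in>N e. P p)" for P
    unfolding Q_def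
  proof (subst eventually_INF_base)
    show "\<exists>x\<in>{0<..}. principal (N x) \<le> inf (principal (N a)) (principal (N b))"
      if "a \<in> {0<..}" "b \<in> {0<..}" for a b
    proof
      show "principal (N (min a b)) \<le> inf (principal (N a)) (principal (N b))"
        using N_mono[OF min.cobounded1, of a b] N_mono[OF min.cobounded2, of a b] by simp
      show "min a b \<in> {0<..}" using that by simp
    qed
    show "(\<exists>b\<in>{0<..}. eventually P (principal (N b))) = (\<exists>e>0. \<forall>p\<in>N e. P p)"
      unfolding eventually_principal by blast
    show "{0::real<..} \<noteq> {}" by simp
  qed
  have comp: "\<exists>D. eventually D Q \<and> (\<forall>x y z. D (x, y) \<longrightarrow> D (y, z) \<longrightarrow> E (x, z))" if E: "eventually E Q" for E
  proof -
    from E obtain e where e: "e > 0" "\<forall>p\<in>N e. E p" unfolding evQ by blast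
    \<comment> \<open>Compactness turns transitivity of \<open>R\<close> into approximate
      transitivity of its thickenings: bad triples would converge to \<open>(a, b)\<close> and
      \<open>(b, c)\<close> in \<open>R\<close>, and then \<open>(a, c)\<close> shows that late
      outer pairs are near \<open>R\<close>.\<close>
    have "\<exists>n. \<forall>u v w. (u, v) \<in> N (inverse (real (Suc n))) \<longrightarrow> (v, w) \<in> N (inverse (real (Suc n))) \<longrightarrow> (u, w) \<in> N e"
    proof (rule ccontr)
      assume "\<not> ?thesis"
      then have "\<forall>n. \<exists>t. (fst t, fst (snd t)) \<in> N (inverse (real (Suc n))) \<and>
          (fst (snd t), snd (snd t)) \<in> N (inverse (real (Suc n))) \<and> (fst t, snd (snd t)) \<notin> N e" by auto
      from choice[OF this] obtain t where t: "\<And>n. (fst (t n), fst (snd (t n))) \<in> N (inverse (real (Suc n)))"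
        "\<And>n. (fst (snd (t n)), snd (snd (t n))) \<in> N (inverse (real (Suc n)))"
        "\<And>n. (fst (t n), snd (snd (t n))) \<notin> N e" by blast
      define u v w where "u n = fst (t n)" and "v n = fst (snd (t n))" and "w n = snd (snd (t n))" for n
      have uv: "\<And>n. (u n, v n) \<in> N (inverse (real (Suc n)))"
        and vw: "\<And>n. (v n, w n) \<in> N (inverse (real (Suc n)))" and uw: "\<And>n. (u n, w n) \<notin> N e"
        using t by (auto simp: u_def v_def w_def)
      \<comment> \<open>Outside \<open>K\<close> only the diagonal is left, so a step that touches
        the outside is stationary; a triple with distinct ends lies in \<open>K\<close>.\<close>
      have nt: "u n \<noteq> w n" for n using uw[of n] by (auto simp: N_def)
      have Kn: "u n \<in> K \<and> v n \<in> K \<and> w n \<in> K" for n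
        using uv[of n] vw[of n] nt[of n] by (auto simp: N_def)
      have nr: "(p, q) \<in> near R (inverse (real (Suc n)))" if "(p, q) \<in> N (inverse (real (Suc n)))" "p \<in> K" for p q n
        using that R_refl unfolding N_def near_def by force
      have "seq_compact (K \<times> K \<times> K)"
        using K compact_Times compact_imp_seq_compact by metis
      moreover have "\<forall>n. (u n, v n, w n) \<in> K \<times> K \<times> K" using Kn by auto
      ultimately obtain l r where r: "strict_mono r" and l: "((\<lambda>n. (u n, v n, w n)) \<circ> r) \<longlonglongrightarrow> l"
        by (rule seq_compactE) blast
      obtain a b c where abc: "l = (a, b, c)" using prod_cases3 by blast
      have lu: "(u \<circ> r) \<longlonglongrightarrow> a" using tendsto_fst[OF l] by (simp add: abc o_def)
      have lv: "(v \<circ> r) \<longlonglongrightarrow> b" using tendsto_fst[OF tendsto_snd[OF l]] by (simp add: abc o_def)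
      have lw: "(w \<circ> r) \<longlonglongrightarrow> c" using tendsto_snd[OF tendsto_snd[OF l]] by (simp add: abc o_def)
      have "(a, b) \<in> R" by (rule near_seq_limit[OF R_closed nr[OF uv] r lu lv]) (use Kn in blast)
      moreover have "(b, c) \<in> R" by (rule near_seq_limit[OF R_closed nr[OF vw] r lv lw]) (use Kn in blast)
      ultimately have ac: "(a, c) \<in> R" using R_trans by blast
      have "eventually (\<lambda>n. dist ((u \<circ> r) n) a < e \<and> dist ((w \<circ> r) n) c < e) sequentially"
        using tendstoD[OF lu e(1)] tendstoD[OF lw e(1)] by eventually_elim auto
      then obtain n where "dist ((u \<circ> r) n) a < e \<and> dist ((w \<circ> r) n) c < e"
        unfolding eventually_sequentially by blast
      then have "(u (r n), w (r n)) \<in> near R e" using ac unfolding near_def by force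
      then show False using uw[of "r n"] Kn[of "r n"] by (auto simp: N_def)
    qed
    then obtain n where n: "\<And>u v w. (u, v) \<in> N (inverse (real (Suc n))) \<Longrightarrow> (v, w) \<in> N (inverse (real (Suc n))) \<Longrightarrow> (u, w) \<in> N e"
      by blast
    have "eventually (\<lambda>p. p \<in> N (inverse (real (Suc n)))) Q"
      unfolding evQ by (intro exI[of _ "inverse (real (Suc n))"]) auto
    then show ?thesis using n e(2) by (intro exI[of _ "\<lambda>p. p \<in> N (inverse (real (Suc n)))"]) blast
  qed
  define A where "A = G `` {x}"
  have sep: "eventually (\<lambda>(p, q). p \<in> A \<longrightarrow> q \<in> - {y}) Q"
  proof (rule ccontr)
    assume "\<not> ?thesis"
    then have neg: "\<exists>p\<in>N e. fst p \<in> A \<and> snd p = y" if "e > 0" for e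
      using that unfolding evQ by (auto simp: split_beta)
    have "\<exists>a. a \<in> A \<and> (a, y) \<in> N (inverse (real (Suc n)))" for n
      using neg[of "inverse (real (Suc n))"] by (metis inverse_positive_iff_positive of_nat_0_less_iff prod.collapse zero_less_Suc)
    then obtain a where aA: "\<And>n. a n \<in> A" and an: "\<And>n. (a n, y) \<in> N (inverse (real (Suc n)))" by metis
    have an': "(a n, y) \<in> near R (inverse (real (Suc n)))" for n
      using an[of n] R_refl[OF xy(2)] unfolding N_def near_def by force
    have aK: "\<forall>n. a n \<in> K" using aA G(2) by (auto simp: A_def)
    obtain l r where r: "strict_mono r" and l: "(a \<circ> r) \<longlonglongrightarrow> l"
      using seq_compactE[OF compact_imp_seq_compact[OF K] aK] by metis
    have ly: "(l, y) \<in> R" by (rule near_seq_limit[where y="\<lambda>_. y", OF R_closed an' r l]) (simp add: o_def)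
    have "(\<lambda>n. (x, (a \<circ> r) n)) \<longlonglongrightarrow> (x, l)" by (intro tendsto_intros l)
    moreover have "\<And>n. (x, (a \<circ> r) n) \<in> G" using aA by (auto simp: A_def)
    ultimately have "(x, l) \<in> G"
      using closed_sequentially[OF G(1), of "\<lambda>n. (x, (a \<circ> r) n)" "(x, l)"] by blast
    then have "(x, y) \<in> G" using ly transD[OF G(3)] by (auto simp: R_def)
    then show False using xy by simp
  qed
  have refl: "E (p, p)" if "eventually E Q" for E p
    using that unfolding evQ N_def by blast
  have "\<exists>L :: 'm \<Rightarrow> real. range L \<subseteq> {0..1} \<and> (\<forall>z\<in>A. L z = 0) \<and> (\<forall>x. x \<notin> - {y} \<longrightarrow> L x = 1) \<and>
    (\<forall>e>0. eventually (\<lambda>(x, y). L y \<le> L x + e) Q)"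
    using sep by (rule quasi_uniform_Urysohn[rotated -1]) (erule refl, erule comp)
  then obtain L :: "'m \<Rightarrow> real" where L': "range L \<subseteq> {0..1} \<and> (\<forall>z\<in>A. L z = 0) \<and> (\<forall>x. x \<notin> - {y} \<longrightarrow> L x = 1) \<and>
    (\<forall>e>0. eventually (\<lambda>(x, y). L y \<le> L x + e) Q)" ..
  then have L: "\<And>x. L x \<in> {0..1}" "\<And>x. x \<in> A \<Longrightarrow> L x = 0" "L y = 1" by (blast, blast, simp)
  have Lev: "\<exists>e'>0. \<forall>p\<in>N e'. L (snd p) \<le> L (fst p) + e" if "e > 0" for e
  proof -
    have "eventually (\<lambda>(x, y). L y \<le> L x + e) Q" using L' that by blast
    then show ?thesis unfolding evQ by (simp add: split_beta)
  qed
  have L_mono: "L q \<le> L p" if "(p, q) \<in> R" for p q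
  proof (rule field_le_epsilon)
    fix e :: real assume "e > 0"
    with Lev obtain e' where "e' > 0" "\<forall>p\<in>N e'. L (snd p) \<le> L (fst p) + e" by blast
    moreover have "(p, q) \<in> N e'" using that R_sub \<open>e' > 0\<close> unfolding N_def near_def by force
    ultimately show "L q \<le> L p + e" by fastforce
  qed
  have L_unif: "\<exists>\<eta>>0. \<forall>p\<in>K. \<forall>q\<in>K. dist p q < \<eta> \<longrightarrow> \<bar>L p - L q\<bar> < e" if e: "e > 0" for e
  proof -
    have "e/2 > 0" using e by simp
    with Lev obtain e' where e': "e' > 0" "\<forall>p\<in>N e'. L (snd p) \<le> L (fst p) + e/2" by blast
    have "\<bar>L p - L q\<bar> < e" if "p \<in> K" "q \<in> K" "dist p q < e'" for p q
    proof -
      have "(p, q) \<in> N e'" "(q, p) \<in> N e'"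
        using that R_refl e'(1) unfolding N_def near_def by (force simp: dist_commute)+
      then show ?thesis using e' e by (fastforce simp: abs_real_def)
    qed
    then show ?thesis using e' by blast
  qed
  \<comment> \<open>\<open>L\<close> vanishes on the image of \<open>x\<close> under
    \<open>G\<close>; closedness and compactness keep it small on edges that start near
    \<open>x\<close>. This is needed because a chain starts near \<open>x\<close>, not at
    \<open>x\<close>, and \<open>L x\<close> may itself be \<open>1\<close>, for instance if
    \<open>x = y\<close>.\<close>
  have "\<exists>n. \<forall>p q. (p, q) \<in> G \<longrightarrow> dist x p < inverse (real (Suc n)) \<longrightarrow> L q < 1/2"
  proof (rule ccontr)
    assume "\<not> ?thesis"
    then have "\<forall>n. \<exists>t. t \<in> G \<and> dist x (fst t) < inverse (real (Suc n)) \<and> \<not> L (snd t) < 1/2" by auto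
    from choice[OF this] obtain t where t: "\<And>n. t n \<in> G" "\<And>n. dist x (fst (t n)) < inverse (real (Suc n))"
      "\<And>n. \<not> L (snd (t n)) < 1/2" by blast
    define p q where "p n = fst (t n)" and "q n = snd (t n)" for n
    have pq: "\<And>n. (p n, q n) \<in> G" "\<And>n. dist x (p n) < inverse (real (Suc n))" "\<And>n. \<not> L (q n) < 1/2"
      using t by (auto simp: p_def q_def)
    have qK: "\<forall>n. q n \<in> K" using pq G(2) by auto
    obtain l r where lK: "l \<in> K" and r: "strict_mono r" and l: "(q \<circ> r) \<longlonglongrightarrow> l"
      using seq_compactE[OF compact_imp_seq_compact[OF K] qK] by metis
    have "(x, q n) \<in> near G (inverse (real (Suc n)))" for n
      using pq[of n] unfolding near_def by force
    then have "(x, l) \<in> G" using near_seq_limit[where x="\<lambda>_. x", OF G(1) _ r _ l] by (simp add: o_def)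
    then have "L l = 0" using L by (auto simp: A_def)
    obtain \<eta> where "\<eta> > 0" "\<forall>p\<in>K. \<forall>q\<in>K. dist p q < \<eta> \<longrightarrow> \<bar>L p - L q\<bar> < 1/2"
      using L_unif[of "1/2"] by auto
    moreover from tendstoD[OF l \<open>\<eta> > 0\<close>] obtain n where "dist (q (r n)) l < \<eta>"
      unfolding eventually_sequentially by auto
    ultimately have "L (q (r n)) < 1/2" using qK lK \<open>L l = 0\<close> by fastforce
    then show False using pq(3) by blast
  qed
  then obtain n where "\<And>p q. (p, q) \<in> G \<Longrightarrow> dist x p < inverse (real (Suc n)) \<Longrightarrow> L q < 1/2" by blast
  then show thesis
    by (intro that[of L "inverse (real (Suc n))"] L L_unif L_mono) (auto simp: R_def)
qed

section \<open>Uniqueness of a compact uniformity\<close>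

lemma uniform_structureD:
  assumes "uniform_structure S V" "eventually E V"
  shows "x \<in> S \<Longrightarrow> E (x, x)" "eventually (\<lambda>(x, y). E (y, x)) V"
    "\<exists>D. eventually D V \<and> (\<forall>x\<in>S. \<forall>y\<in>S. \<forall>z\<in>S. D (x, y) \<longrightarrow> D (y, z) \<longrightarrow> E (x, z))"
  using assms unfolding uniform_structure_def by blast+

lemma uniform_structure_eventually_in:
  assumes "uniform_structure S V"
  shows "eventually (\<lambda>p. p \<in> S \<times> S) V"
  using assms unfolding uniform_structure_def le_principal by blast

text \<open>An entourage ball need not be open; the points around which \<open>E (p, _)\<close>
  holds locally form an open core of it.\<close>

lemma uniform_topology_neighbourhood:
  assumes V: "uniform_structure S V" and E: "eventually E V" and p: "p \<in> S"
  shows "\<exists>A. openin (uniform_topology S V) A \<and> p \<in> A \<and> A \<subseteq> {q \<in> S. E (p, q)}"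
proof -
  define A where "A = {q \<in> S. eventually (\<lambda>(x', y). x' = q \<longrightarrow> E (p, y)) V}"
  have "eventually (\<lambda>(x', y). x' = q \<longrightarrow> y \<in> A) V" if q: "q \<in> A" for q
  proof -
    have "eventually (\<lambda>(x', y). x' = q \<longrightarrow> E (p, y)) V" using q by (simp add: A_def)
    from uniform_structureD(3)[OF V this] obtain D where D: "eventually D V"
      "\<And>x y z. x \<in> S \<Longrightarrow> y \<in> S \<Longrightarrow> z \<in> S \<Longrightarrow> D (x, y) \<Longrightarrow> D (y, z) \<Longrightarrow> x = q \<longrightarrow> E (p, z)" by auto
    have DS: "eventually (\<lambda>r. D r \<and> r \<in> S \<times> S) V"
      using eventually_conj[OF D(1) uniform_structure_eventually_in[OF V]] .
    show ?thesis using DS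
    proof eventually_elim
      case (elim r)
      obtain x' y where r: "r = (x', y)" by fastforce
      have "y \<in> A" if x': "x' = q"
      proof -
        have "eventually (\<lambda>(a, b). a = y \<longrightarrow> E (p, b)) V"
          using DS by eventually_elim (use elim r x' D(2) in auto)
        then show ?thesis using elim r by (simp add: A_def)
      qed
      then show ?case by (simp add: r)
    qed
  qed
  then have "openin (uniform_topology S V) A" by (auto simp: openin_uniform_topology A_def)
  moreover have "p \<in> A" using E p unfolding A_def by (auto elim: eventually_mono)
  moreover have "A \<subseteq> {q \<in> S. E (p, q)}" using uniform_structureD(1)[OF V] by (auto simp: A_def)
  ultimately show ?thesis by blast
qed

text \<open>A Lebesgue number argument. Around each \<open>p\<close> there is an open set on which
  one entourage of \<open>V\<close> forces \<open>E\<close>; a finite subcover leaves finitely many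
  entourages to intersect. Exchanging the two uniformities then gives uniqueness.\<close>

lemma compact_uniformity_le:
  assumes V: "uniform_structure S V" and W: "uniform_structure S W"
    and top: "uniform_topology S W = uniform_topology S V"
    and cpt: "compact_space (uniform_topology S V)"
  shows "V \<le> W"
proof (rule filter_leI)
  fix E assume E: "eventually E W"
  have "\<exists>G B. eventually G V \<and> openin (uniform_topology S V) B \<and> p \<in> B \<and>
      (\<forall>u\<in>B. \<forall>v\<in>S. G (u, v) \<longrightarrow> E (u, v))" if p: "p \<in> S" for p
  proof -
    from uniform_structureD(3)[OF W E] obtain D where D: "eventually D W"
      "\<And>x y z. x \<in> S \<Longrightarrow> y \<in> S \<Longrightarrow> z \<in> S \<Longrightarrow> D (x, y) \<Longrightarrow> D (y, z) \<Longrightarrow> E (x, z)" by blast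
    \<comment> \<open>With both orientations of \<open>D\<close> on the ball, any two of its points
      are joined through the centre \<open>p\<close>.\<close>
    have "eventually (\<lambda>r. D r \<and> (case r of (x, y) \<Rightarrow> D (y, x))) W"
      using D(1) uniform_structureD(2)[OF W D(1)] by (rule eventually_conj)
    from uniform_topology_neighbourhood[OF W this p] obtain A where A: "openin (uniform_topology S V) A"
      "p \<in> A" "\<And>q. q \<in> A \<Longrightarrow> q \<in> S \<and> D (p, q) \<and> D (q, p)" unfolding top by auto
    then have "eventually (\<lambda>(x', y). x' = p \<longrightarrow> y \<in> A) V" by (simp add: openin_uniform_topology)
    from uniform_structureD(3)[OF V this] obtain G where G: "eventually G V"
      "\<And>y z. y \<in> S \<Longrightarrow> z \<in> S \<Longrightarrow> G (p, y) \<Longrightarrow> G (y, z) \<Longrightarrow> z \<in> A" using p by auto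
    from uniform_topology_neighbourhood[OF V G(1) p] obtain B where B: "openin (uniform_topology S V) B"
      "p \<in> B" "\<And>q. q \<in> B \<Longrightarrow> q \<in> S \<and> G (p, q)" by auto
    have "E (u, v)" if "u \<in> A" "v \<in> A" for u v
      using D(2)[of u p v] A(3)[OF that(1)] A(3)[OF that(2)] p by blast
    moreover have "v \<in> A" if "u \<in> B" "v \<in> S" "G (u, v)" for u v
      using G(2)[of u v] B(3)[OF that(1)] that by blast
    ultimately have "E (u, v)" if "u \<in> B \<inter> A" "v \<in> S" "G (u, v)" for u v
      using that by blast
    then show ?thesis
      using G(1) A(1,2) B(1,2) by (intro exI[of _ G] exI[of _ "B \<inter> A"]) auto
  qed
  then have "\<forall>p\<in>S. \<exists>GB. eventually (fst GB) V \<and> openin (uniform_topology S V) (snd GB) \<and> p \<in> snd GB \<and>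
      (\<forall>u\<in>snd GB. \<forall>v\<in>S. fst GB (u, v) \<longrightarrow> E (u, v))" by auto
  from bchoice[OF this] obtain GB where GB: "\<forall>p\<in>S. eventually (fst (GB p)) V \<and>
      openin (uniform_topology S V) (snd (GB p)) \<and> p \<in> snd (GB p) \<and>
      (\<forall>u\<in>snd (GB p). \<forall>v\<in>S. fst (GB p) (u, v) \<longrightarrow> E (u, v))" ..
  have "S \<subseteq> \<Union>((\<lambda>p. snd (GB p)) ` S)" using GB by blast
  then have "\<exists>F. finite F \<and> F \<subseteq> (\<lambda>p. snd (GB p)) ` S \<and> S \<subseteq> \<Union>F"
    using cpt GB unfolding compact_space_alt topspace_uniform_topology[OF V] by (metis (no_types, lifting) imageE)
  then obtain F where F: "finite F" "F \<subseteq> (\<lambda>p. snd (GB p)) ` S" "S \<subseteq> \<Union>F" by blast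
  from finite_subset_image[OF F(1,2)] obtain P where P: "P \<subseteq> S" "finite P" "F = (\<lambda>p. snd (GB p)) ` P" by blast
  have "eventually (\<lambda>r. \<forall>p\<in>P. fst (GB p) r) V"
    using P GB by (intro eventually_ball_finite) auto
  with uniform_structure_eventually_in[OF V] show "eventually E V"
  proof eventually_elim
    case (elim r)
    obtain u v where r: "r = (u, v)" by fastforce
    then obtain p where "p \<in> P" "u \<in> snd (GB p)" using elim F(3) P(3) by auto
    then show ?case using GB P(1) elim r by blast
  qed
qed

lemma compact_uniformity_unique:
  assumes "uniform_structure S V" "uniform_structure S W"
    "uniform_topology S W = uniform_topology S V" "compact_space (uniform_topology S V)"
  shows "W = V"
  using compact_uniformity_le[of S V W] compact_uniformity_le[of S W V] assms by (simp add: order_antisym)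

section \<open>Chains and separating functions\<close>

lemma uniformly_continuous_on_UNIV_real_iff:
  fixes \<phi> :: "'a::uniform_space \<Rightarrow> real"
  shows "uniformly_continuous_on UNIV \<phi> \<longleftrightarrow>
    (\<forall>e>0. eventually (\<lambda>(x, y). \<bar>\<phi> x - \<phi> y\<bar> < e) uniformity)"
  unfolding uniformly_continuous_on_uniformity uniformity_dist[where 'a=real]
  by (simp add: filterlim_INF filterlim_principal dist_real_def case_prod_beta' Ball_def)

lemma gage_pseudometric:
  assumes "d \<in> gage UNIV V"
  shows "d x x = 0" "0 \<le> d x y" "d x y = d y x" "d x z \<le> d x y + d y z"
  using assms unfolding gage_def bounded_pseudometric_def by blast+

text \<open>Symmetry of the uniformity turns the one-sided estimate of the Urysohn lemma into
  uniform continuity.\<close>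

lemma uniform_space_completely_regular:
  fixes x :: "'a::uniform_space"
  assumes "open A" "x \<in> A"
  obtains \<phi> :: "'a \<Rightarrow> real" where "uniformly_continuous_on UNIV \<phi>"
    "\<And>z. \<phi> z \<in> {0..1}" "\<phi> x = 0" "\<And>z. z \<notin> A \<Longrightarrow> \<phi> z = 1"
proof -
  have "eventually (\<lambda>(x', y). x' \<in> {x} \<longrightarrow> y \<in> A) uniformity"
    using assms by (simp add: open_uniformity)
  then have "\<exists>\<phi> :: 'a \<Rightarrow> real. range \<phi> \<subseteq> {0..1} \<and> (\<forall>z\<in>{x}. \<phi> z = 0) \<and> (\<forall>x. x \<notin> A \<longrightarrow> \<phi> x = 1) \<and>
    (\<forall>e>0. eventually (\<lambda>(x, y). \<phi> y \<le> \<phi> x + e) uniformity)"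
    by (rule quasi_uniform_Urysohn[rotated -1]) (erule uniformity_refl, erule uniformity_trans)
  then obtain \<phi> :: "'a \<Rightarrow> real" where \<phi>: "range \<phi> \<subseteq> {0..1} \<and> (\<forall>z\<in>{x}. \<phi> z = 0) \<and> (\<forall>x. x \<notin> A \<longrightarrow> \<phi> x = 1) \<and>
    (\<forall>e>0. eventually (\<lambda>(x, y). \<phi> y \<le> \<phi> x + e) uniformity)" ..
  have half: "eventually (\<lambda>(x, y). \<phi> y \<le> \<phi> x + e) uniformity" if "e > 0" for e
    using \<phi> that by blast
  have ev: "eventually (\<lambda>(x, y). \<bar>\<phi> x - \<phi> y\<bar> < e) uniformity" if "e > 0" for e
  proof -
    have *: "eventually (\<lambda>(x, y). \<phi> y \<le> \<phi> x + e/2) uniformity" using half[of "e/2"] that by simp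
    show ?thesis using * uniformity_sym[OF *] by eventually_elim (use that in \<open>auto simp: abs_real_def\<close>)
  qed
  show ?thesis
  proof (rule that[of \<phi>])
    show "uniformly_continuous_on UNIV \<phi>"
      unfolding uniformly_continuous_on_UNIV_real_iff using ev by blast
    show "\<phi> z \<in> {0..1}" for z using \<phi> by blast
    show "\<phi> x = 0" using \<phi> by blast
    show "\<phi> z = 1" if "z \<notin> A" for z using \<phi> that by blast
  qed
qed

lemma uniformly_continuous_if_Lipschitz_gage:
  fixes \<phi> :: "'a::uniform_space \<Rightarrow> real"
  assumes "d \<in> gage UNIV uniformity" "\<And>x y. \<phi> x \<le> \<phi> y + C * d x y" "C > 0"
  shows "uniformly_continuous_on UNIV \<phi>"
  unfolding uniformly_continuous_on_UNIV_real_iff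
proof (intro allI impI)
  fix e :: real assume "e > 0"
  then have "eventually (\<lambda>(x, y). d x y < e / C) uniformity"
    using assms by (auto simp: gage_def)
  then show "eventually (\<lambda>(x, y). \<bar>\<phi> x - \<phi> y\<bar> < e) uniformity"
  proof eventually_elim
    case (elim p)
    obtain x y where p: "p = (x, y)" by fastforce
    have "d y x = d x y" using assms(1) by (auto simp: gage_def bounded_pseudometric_def)
    then show ?case using elim assms(2)[of x y] assms(2)[of y x] assms(3) p
      by (simp add: field_simps abs_real_def)
  qed
qed

text \<open>The list records the jumps made so far. The final jump is left open, so that the target
  can vary when lengths become functions of it. Summing the list serves \<open>A_rel\<close>,
  bounding its members serves \<open>C_rel\<close>.\<close>

inductive chain :: "('a \<Rightarrow> 'a \<Rightarrow> real) \<Rightarrow> ('a \<times> 'a) set \<Rightarrow> 'a \<Rightarrow> 'a \<Rightarrow> real list \<Rightarrow> bool"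
  for d f x where
  chain_start: "(a, b) \<in> f \<Longrightarrow> chain d f x b [d x a]"
| chain_step: "chain d f x b js \<Longrightarrow> (a, b') \<in> f \<Longrightarrow> chain d f x b' (js @ [d b a])"

lemma chain_sequences:
  assumes "chain d f x z js"
  shows "\<exists>n\<ge>1. \<exists>a b. (\<forall>i\<in>{1..n}. (a i, b i) \<in> f) \<and> b n = z \<and>
    js = d x (a 1) # map (\<lambda>i. d (b i) (a (Suc i))) [1..<n]"
  using assms
proof induction
  case (chain_start a b)
  then show ?case
    by (intro exI[of _ 1] conjI exI[of _ "\<lambda>_. a"] exI[of _ "\<lambda>_. b"]) auto
next
  case (chain_step b' js a' c)
  then obtain n a b where n: "n \<ge> 1" and ab: "\<forall>i\<in>{1..n}. (a i, b i) \<in> f" "b n = b'"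
    "js = d x (a 1) # map (\<lambda>i. d (b i) (a (Suc i))) [1..<n]" by blast
  define a2 b2 where "a2 = a(Suc n := a')" and "b2 = b(Suc n := c)"
  have "\<forall>i\<in>{1..Suc n}. (a2 i, b2 i) \<in> f"
    using ab chain_step by (auto simp: a2_def b2_def)
  moreover have "js @ [d b' a'] = d x (a2 1) # map (\<lambda>i. d (b2 i) (a2 (Suc i))) [1..<Suc n]"
    using ab n by (auto simp: a2_def b2_def)
  moreover have "b2 (Suc n) = c" by (simp add: b2_def)
  ultimately show ?case using n by (intro exI[of _ "Suc n"]) auto
qed

text \<open>
  For a chain length function \<open>j\<close> from \<open>x\<close> and \<open>h = min (d x) j\<close>, an edge \<open>(a, b)\<close> costs nothing whether the
  chain enters it from \<open>a\<close> near \<open>x\<close> or after other edges, so \<open>j b \<le> h a\<close>. Using two functions instead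
  of \<open>j\<close> alone is what decides the diagonal pairs, where \<open>j x\<close> need not vanish. The constant \<open>1\<close> in the
  infimum keeps it meaningful when there are no chains at all.
\<close>

lemma A_rel_separation:
  fixes f :: "('a::uniform_space \<times> 'a) set"
  assumes "(x, y) \<notin> A_rel UNIV uniformity f"
  obtains h j :: "'a \<Rightarrow> real" where "uniformly_continuous_on UNIV h" "uniformly_continuous_on UNIV j"
    "\<And>z. h z \<in> {0..1}" "\<And>z. j z \<in> {0..1}" "\<And>z. h z \<le> j z"
    "\<And>a b. (a, b) \<in> f \<Longrightarrow> j b \<le> h a" "h x < j y"
proof -
  from assms obtain d e where d: "d \<in> gage UNIV uniformity" and e: "e > 0"
    and no: "\<not> (\<exists>n\<ge>1. \<exists>a b. (\<forall>i\<in>{1..n}. (a i, b i) \<in> f) \<and>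
        d x (a 1) + (\<Sum>i = 1..<n. d (b i) (a (Suc i))) + d (b n) y < e)"
    by (auto simp: A_rel_def)
  have d0: "d z z = 0" and dpos: "0 \<le> d z w" and dsym: "d z w = d w z"
    and dtri: "d z v \<le> d z w + d w v" for z w v
    using gage_pseudometric[OF d] by blast+
  have no_chain: "e \<le> sum_list js + d b y" if ch: "chain d f x b js" for b js
  proof (rule ccontr)
    assume *: "\<not> e \<le> sum_list js + d b y"
    from chain_sequences[OF ch] obtain n a b' where n: "n \<ge> 1" "\<forall>i\<in>{1..n}. (a i, b' i) \<in> f"
      "b' n = b" and js: "js = d x (a 1) # map (\<lambda>i. d (b' i) (a (Suc i))) [1..<n]" by blast
    have "sum_list js = d x (a 1) + (\<Sum>i = 1..<n. d (b' i) (a (Suc i)))"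
      unfolding js by (simp add: interv_sum_list_conv_sum_set_nat)
    then have "d x (a 1) + (\<Sum>i = 1..<n. d (b' i) (a (Suc i))) + d (b' n) y < e"
      using * n(3) by simp
    then show False using no n(1,2) by blast
  qed
  have chain_pos: "0 \<le> sum_list js" if "chain d f x b js" for b js
    using that by induction (auto simp: dpos)
  define S where "S z = insert 1 {sum_list js + d b z | b js. chain d f x b js}" for z
  define j where "j z = Inf (S z)" for z
  define h where "h z = min (d x z) (j z)" for z
  have bdd: "bdd_below (S z)" for z
    by (rule bdd_belowI[of _ 0]) (auto simp: S_def intro: add_nonneg_nonneg chain_pos dpos)
  have ne: "S z \<noteq> {}" for z by (simp add: S_def)
  have j_le: "j z \<le> s" if "s \<in> S z" for s z
    unfolding j_def using cInf_lower[OF that bdd] .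
  have j_ge: "s \<le> j z" if "\<And>t. t \<in> S z \<Longrightarrow> s \<le> t" for s z
    unfolding j_def by (rule cInf_greatest[OF ne that])
  have j_bd: "0 \<le> j z" "j z \<le> 1" for z
    by (rule j_ge, auto simp: S_def intro: add_nonneg_nonneg chain_pos dpos)
       (rule j_le, simp add: S_def)
  have j_Lip: "j z \<le> j w + 1 * d z w" for z w
  proof -
    have "j z - d z w \<le> j w"
    proof (rule j_ge)
      fix t assume "t \<in> S w"
      then consider "t = 1" | b js where "chain d f x b js" "t = sum_list js + d b w"
        by (auto simp: S_def)
      then show "j z - d z w \<le> t"
      proof cases
        case 1 then show ?thesis using j_bd[of z] dpos[of z w] by linarith
      next
        case 2
        then have "j z \<le> sum_list js + d b z" by (intro j_le) (auto simp: S_def)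
        then show ?thesis using 2 dtri[of b z w] dsym[of z w] by linarith
      qed
    qed
    then show ?thesis by simp
  qed
  have h_Lip: "h z \<le> h w + 1 * d z w" for z w
    using j_Lip[of z w] dtri[of x z w] dsym[of z w] by (auto simp: h_def min_def)
  have f_decr: "j b \<le> h a" if ab: "(a, b) \<in> f" for a b
  proof -
    have "j b \<le> d x a"
      using chain_start[of a b f d x] ab by (intro j_le) (force simp: S_def d0)
    moreover have "j b \<le> j a"
    proof (rule j_ge)
      fix t assume "t \<in> S a"
      then consider "t = 1" | b' js where "chain d f x b' js" "t = sum_list js + d b' a"
        by (auto simp: S_def)
      then show "j b \<le> t"
      proof cases
        case 2
        have "chain d f x b (js @ [d b' a])" using chain_step[OF 2(1) ab] .
        then show ?thesis using 2 by (intro j_le) (force simp: S_def d0)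
      qed (use j_bd in simp)
    qed
    ultimately show ?thesis by (simp add: h_def)
  qed
  \<comment> \<open>The gap: \<open>h x = 0\<close> because \<open>d x x = 0\<close>, while every
    chain to \<open>y\<close> costs at least \<open>e\<close>.\<close>
  have "min e 1 \<le> j y" by (rule j_ge) (auto simp: S_def dest: no_chain)
  then have "h x < j y" using e by (auto simp: h_def d0)
  moreover have "uniformly_continuous_on UNIV h" "uniformly_continuous_on UNIV j"
    using uniformly_continuous_if_Lipschitz_gage[OF d h_Lip] uniformly_continuous_if_Lipschitz_gage[OF d j_Lip]
    by simp_all
  moreover have "h z \<in> {0..1}" "j z \<in> {0..1}" "h z \<le> j z" for z
    using j_bd[of z] dpos[of x z] by (auto simp: h_def)
  ultimately show thesis using that f_decr by blast
qed

text \<open>Let \<open>B\<close> consist of the endpoints of chains from \<open>x\<close> with all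
  jumps below \<open>e\<close>; then \<open>j\<close> is the distance to \<open>B\<close> in units
  of \<open>e\<close>, cut off at \<open>1\<close>. If \<open>h a < 1\<close>, then \<open>a\<close>
  is within \<open>e\<close> of \<open>x\<close> or of a point of \<open>B\<close>, so an edge from
  \<open>a\<close> ends in \<open>B\<close>, where \<open>j\<close> vanishes. As \<open>y\<close>
  keeps distance at least \<open>e\<close> from \<open>B\<close>, \<open>j y = 1\<close>, whereas
  \<open>h x = 0\<close>. The threshold \<open>1/2\<close> leaves room for a jump at either end and
  makes the conditions on \<open>(x, y)\<close> open.\<close>

lemma C_rel_separation:
  fixes f :: "('a::uniform_space \<times> 'a) set"
  assumes "(x, y) \<notin> C_rel UNIV uniformity f"
  obtains h j :: "'a \<Rightarrow> real" where "uniformly_continuous_on UNIV h" "uniformly_continuous_on UNIV j"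
    "\<And>z. h z \<in> {0..1}" "\<And>z. j z \<in> {0..1}" "\<And>z. h z \<le> j z"
    "\<And>a b. (a, b) \<in> f \<Longrightarrow> h a < 1 \<Longrightarrow> j b = 0" "h x < 1/2" "1/2 < j y"
proof -
  from assms obtain d e where d: "d \<in> gage UNIV uniformity" and e: "e > 0"
    and no: "\<not> (\<exists>n\<ge>1. \<exists>a b. (\<forall>i\<in>{1..n}. (a i, b i) \<in> f) \<and>
        Max ({d x (a 1), d (b n) y} \<union> (\<lambda>i. d (b i) (a (Suc i))) ` {1..<n}) < e)"
    by (auto simp: C_rel_def)
  have d0: "d z z = 0" and dpos: "0 \<le> d z w" and dsym: "d z w = d w z"
    and dtri: "d z v \<le> d z w + d w v" for z w v
    using gage_pseudometric[OF d] by blast+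
  define B where "B = {b. \<exists>js. chain d f x b js \<and> (\<forall>j\<in>set js. j < e)}"
  have no_chain: "e \<le> d b y" if "b \<in> B" for b
  proof (rule ccontr)
    assume *: "\<not> e \<le> d b y"
    from that obtain js where ch: "chain d f x b js" and small: "\<forall>j\<in>set js. j < e" by (auto simp: B_def)
    from chain_sequences[OF ch] obtain n a b' where n: "n \<ge> 1" "\<forall>i\<in>{1..n}. (a i, b' i) \<in> f"
      "b' n = b" and js: "js = d x (a 1) # map (\<lambda>i. d (b' i) (a (Suc i))) [1..<n]" by blast
    have "Max ({d x (a 1), d (b' n) y} \<union> (\<lambda>i. d (b' i) (a (Suc i))) ` {1..<n}) < e"
      using * small n(3) by (subst Max_less_iff) (auto simp: js)
    then show False using no n(1,2) by blast
  qed
  have B_start: "b \<in> B" if "(a, b) \<in> f" "d x a < e" for a b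
    using chain_start[OF that(1), of d x] that(2) unfolding B_def by force
  have B_step: "b' \<in> B" if "b \<in> B" "(a, b') \<in> f" "d b a < e" for a b b'
  proof -
    from that obtain js where "chain d f x b js" "\<forall>j\<in>set js. j < e" by (auto simp: B_def)
    then have "chain d f x b' (js @ [d b a])" "\<forall>j\<in>set (js @ [d b a]). j < e"
      by (auto intro: chain_step[OF _ that(2)] simp: that(3))
    then show ?thesis unfolding B_def by blast
  qed
  define S where "S z = insert 1 {d b z / e | b. b \<in> B}" for z
  define j where "j z = Inf (S z)" for z
  define h where "h z = min (d x z / e) (j z)" for z
  have bdd: "bdd_below (S z)" for z
    by (rule bdd_belowI[of _ 0]) (use e in \<open>auto simp: S_def dpos\<close>)
  have ne: "S z \<noteq> {}" for z by (simp add: S_def)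
  have j_le: "j z \<le> s" if "s \<in> S z" for s z
    unfolding j_def using cInf_lower[OF that bdd] .
  have j_ge: "s \<le> j z" if "\<And>t. t \<in> S z \<Longrightarrow> s \<le> t" for s z
    unfolding j_def by (rule cInf_greatest[OF ne that])
  have j_bd: "0 \<le> j z" "j z \<le> 1" for z
    by (rule j_ge, use e in \<open>auto simp: S_def dpos\<close>)
       (rule j_le, simp add: S_def)
  have j_Lip: "j z \<le> j w + (1 / e) * d z w" for z w
  proof -
    have "j z - d z w / e \<le> j w"
    proof (rule j_ge)
      fix t assume "t \<in> S w"
      then consider "t = 1" | b where "b \<in> B" "t = d b w / e"
        by (auto simp: S_def)
      then show "j z - d z w / e \<le> t"
      proof cases
        case 1
        moreover have "0 \<le> d z w / e" using dpos[of z w] e by simp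
        ultimately show ?thesis using j_bd[of z] by linarith
      next
        case 2
        then have "j z \<le> d b z / e" by (intro j_le) (auto simp: S_def)
        also have "\<dots> \<le> (d b w + d z w) / e"
          using dtri[of b z w] dsym[of z w] e by (intro divide_right_mono) auto
        finally show ?thesis using 2 by (simp add: add_divide_distrib)
      qed
    qed
    then show ?thesis by simp
  qed
  have h_Lip: "h z \<le> h w + (1 / e) * d z w" for z w
  proof -
    have "d x z / e \<le> (d x w + d z w) / e"
      using dtri[of x z w] dsym[of z w] e by (intro divide_right_mono) auto
    then show ?thesis
      using j_Lip[of z w] by (auto simp: h_def min_def add_divide_distrib)
  qed
  have f_zero: "j b = 0" if ab: "(a, b) \<in> f" and ha: "h a < 1" for a b
  proof -
    consider "d x a / e < 1" | "j a < 1" using ha by (auto simp: h_def min_def split: if_splits)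
    then have "b \<in> B"
    proof cases
      case 1 then show ?thesis using ab B_start e by (auto simp: field_simps)
    next
      case 2
      then obtain t where "t \<in> S a" "t < 1"
        unfolding j_def by (subst (asm) cInf_less_iff[OF ne bdd]) auto
      then obtain b' where "b' \<in> B" "d b' a / e < 1" by (auto simp: S_def)
      then have "b' \<in> B" "d b' a < e" using e by (auto simp: field_simps)
      then show ?thesis using B_step ab by blast
    qed
    then have "j b \<le> 0" by (intro j_le) (force simp: S_def d0)
    then show ?thesis using j_bd[of b] by simp
  qed
  have "1 \<le> j y" by (rule j_ge) (use no_chain e in \<open>auto simp: S_def\<close>)
  then have "1/2 < j y" by simp
  moreover have "h x < 1/2" using j_bd[of x] by (simp add: h_def d0)
  moreover have "uniformly_continuous_on UNIV h" "uniformly_continuous_on UNIV j"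
    using uniformly_continuous_if_Lipschitz_gage[OF d h_Lip] uniformly_continuous_if_Lipschitz_gage[OF d j_Lip]
    e by simp_all
  moreover have "h z \<in> {0..1}" "j z \<in> {0..1}" "h z \<le> j z" for z
    using j_bd[of z] dpos[of x z] e by (auto simp: h_def)
  ultimately show thesis using that f_zero by blast
qed

text \<open>Lindelof in indexed form: countably many indices are kept, not just open sets, because
  the functions behind the sets become coordinates.\<close>

lemma countable_subfamily_covering:
  fixes U :: "'c \<Rightarrow> 'b::second_countable_topology set"
  assumes "\<And>w. w \<in> I \<Longrightarrow> open (U w)" "W \<subseteq> (\<Union>w\<in>I. U w)"
  obtains J where "J \<subseteq> I" "countable J" "W \<subseteq> (\<Union>w\<in>J. U w)"
proof -
  obtain F where F: "F \<subseteq> U ` I" "countable F" "\<Union>F = \<Union>(U ` I)"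
    using Lindelof[of "U ` I"] assms(1) by blast
  have "\<exists>J. countable J \<and> J \<subseteq> I \<and> F = U ` J"
    by (rule countable_subset_image[THEN iffD1]) (use F in simp)
  then obtain J where "countable J" "J \<subseteq> I" and "F = U ` J" by auto
  have "W \<subseteq> (\<Union>w\<in>J. U w)"
    using assms(2) F(3) \<open>F = U ` J\<close> by simp
  with \<open>J \<subseteq> I\<close> \<open>countable J\<close> show thesis by (rule that)
qed

lemma A_relD:
  assumes "(x, y) \<in> A_rel S V f" "d \<in> gage S V" "0 < r"
  obtains n a b where "n \<ge> 1" "\<And>k. k \<in> {1..n} \<Longrightarrow> (a k, b k) \<in> f"
    "d x (a 1) + (\<Sum>k = 1..<n. d (b k) (a (Suc k))) + d (b n) y < r"
proof -
  have "\<forall>d\<in>gage S V. \<forall>r>0. \<exists>n\<ge>1. \<exists>a b. (\<forall>k\<in>{1..n}. (a k, b k) \<in> f) \<and>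
        d x (a 1) + (\<Sum>k = 1..<n. d (b k) (a (Suc k))) + d (b n) y < r"
    using assms(1) unfolding A_rel_def mem_Collect_eq case_prod_conv by (elim conjE)
  from this[rule_format, OF assms(2,3)] obtain n a b where "n \<ge> 1" "\<forall>k\<in>{1..n}. (a k, b k) \<in> f"
        "d x (a 1) + (\<Sum>k = 1..<n. d (b k) (a (Suc k))) + d (b n) y < r"
    by (elim exE conjE) (rule that; assumption)
  then show thesis by (intro that[of n a b]) auto
qed

lemma C_relD:
  assumes "(x, y) \<in> C_rel S V f" "d \<in> gage S V" "0 < r"
  obtains n a b where "n \<ge> 1" "\<And>k. k \<in> {1..n} \<Longrightarrow> (a k, b k) \<in> f"
    "d x (a 1) < r" "\<And>k. k \<in> {1..<n} \<Longrightarrow> d (b k) (a (Suc k)) < r" "d (b n) y < r"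
proof -
  have "\<forall>d\<in>gage S V. \<forall>r>0. \<exists>n\<ge>1. \<exists>a b. (\<forall>k\<in>{1..n}. (a k, b k) \<in> f) \<and>
        Max ({d x (a 1), d (b n) y} \<union> (\<lambda>k. d (b k) (a (Suc k))) ` {1..<n}) < r"
    using assms(1) unfolding C_rel_def mem_Collect_eq case_prod_conv by (elim conjE)
  from this[rule_format, OF assms(2,3)] obtain n a b where "n \<ge> 1" "\<forall>k\<in>{1..n}. (a k, b k) \<in> f"
        "Max ({d x (a 1), d (b n) y} \<union> (\<lambda>k. d (b k) (a (Suc k))) ` {1..<n}) < r"
    by (elim exE conjE) (rule that; assumption)
  then show thesis by (intro that[of n a b]) auto
qed

section \<open>Compact metric spaces copied along an injection\<close>

text \<open>The cube supplies metric and compactness, but the points of the completion have to be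
  filters on \<open>X\<close>. Transporting the uniformity of \<open>K\<close> along an injection
  separates the two concerns, and the metric arguments stay in \<open>K\<close>.\<close>

locale compact_metric_copy =
  fixes K :: "'m::metric_space set" and \<iota> :: "'m \<Rightarrow> 'b"
  assumes compact_K: "compact K" and inj_\<iota>: "inj_on \<iota> K"
begin

definition Y :: "'b set" where "Y = \<iota> ` K"

definition V :: "('b \<times> 'b) filter" where
  "V = (INF r\<in>{0<..}. principal (map_prod \<iota> \<iota> ` {(p, q). p \<in> K \<and> q \<in> K \<and> dist p q < r}))"

abbreviation "Z \<equiv> uniform_topology Y V"

definition \<kappa> :: "'b \<Rightarrow> 'm" where "\<kappa> = inv_into K \<iota>"

lemma \<kappa>_\<iota> [simp]: "p \<in> K \<Longrightarrow> \<kappa> (\<iota> p) = p"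
  unfolding \<kappa>_def by (rule inv_into_f_f[OF inj_\<iota>])

lemma \<iota>_\<kappa> [simp]: "y \<in> Y \<Longrightarrow> \<iota> (\<kappa> y) = y"
  unfolding \<kappa>_def Y_def by (rule f_inv_into_f)

lemma \<kappa>_in [simp]: "y \<in> Y \<Longrightarrow> \<kappa> y \<in> K"
  unfolding \<kappa>_def Y_def by (rule inv_into_into)

lemma \<iota>_in [simp]: "p \<in> K \<Longrightarrow> \<iota> p \<in> Y"
  by (simp add: Y_def)

lemma \<iota>_eq_iff: "p \<in> K \<Longrightarrow> q \<in> K \<Longrightarrow> \<iota> p = \<iota> q \<longleftrightarrow> p = q"
  using inj_\<iota> by (auto simp: inj_on_def)

lemma eventually_V:
  "eventually P V \<longleftrightarrow> (\<exists>r>0. \<forall>p\<in>K. \<forall>q\<in>K. dist p q < r \<longrightarrow> P (\<iota> p, \<iota> q))"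
proof -
  have "eventually P V \<longleftrightarrow>
    (\<exists>r\<in>{0<..}. eventually P (principal (map_prod \<iota> \<iota> ` {(p, q). p \<in> K \<and> q \<in> K \<and> dist p q < r})))"
    unfolding V_def
  proof (rule eventually_INF_base)
    fix a b :: real assume ab: "a \<in> {0<..}" "b \<in> {0<..}"
    show "\<exists>x\<in>{0<..}. principal (map_prod \<iota> \<iota> ` {(p, q). p \<in> K \<and> q \<in> K \<and> dist p q < x})
      \<le> inf (principal (map_prod \<iota> \<iota> ` {(p, q). p \<in> K \<and> q \<in> K \<and> dist p q < a}))
            (principal (map_prod \<iota> \<iota> ` {(p, q). p \<in> K \<and> q \<in> K \<and> dist p q < b}))"
      by (rule bexI[of _ "min a b"]) (use ab in auto)
  qed simp
  also have "\<dots> \<longleftrightarrow> (\<exists>r>0. \<forall>p\<in>K. \<forall>q\<in>K. dist p q < r \<longrightarrow> P (\<iota> p, \<iota> q))"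
    by (simp add: eventually_principal Bex_def) auto
  finally show ?thesis .
qed

lemma uniform_structure_V: "uniform_structure Y V"
  unfolding uniform_structure_def
proof (intro conjI allI impI ballI)
  show "V \<le> principal (Y \<times> Y)"
    unfolding le_principal eventually_V by (auto intro!: exI[of _ 1])
  fix E assume E: "eventually E V"
  then obtain r where r: "r > 0" "\<And>p q. p \<in> K \<Longrightarrow> q \<in> K \<Longrightarrow> dist p q < r \<Longrightarrow> E (\<iota> p, \<iota> q)"
    unfolding eventually_V by auto
  show "E (x, x)" if "x \<in> Y" for x using r(2)[of "\<kappa> x" "\<kappa> x"] r(1) that by simp
  show "eventually (\<lambda>(x, y). E (y, x)) V"
    unfolding eventually_V using r by (auto simp: dist_commute)
  define D where "D = (\<lambda>(x, y). dist (\<kappa> x) (\<kappa> y) < r/2)"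
  have "eventually D V" unfolding eventually_V D_def using r(1) by (intro exI[of _ "r/2"]) auto
  moreover have "E (x, z)" if "x \<in> Y" "y \<in> Y" "z \<in> Y" "D (x, y)" "D (y, z)" for x y z
  proof -
    have "dist (\<kappa> x) (\<kappa> z) < r" using that(4,5) dist_triangle_half_l[of "\<kappa> x" "\<kappa> y" r "\<kappa> z"]
      by (simp add: D_def dist_commute)
    then show ?thesis using r(2)[of "\<kappa> x" "\<kappa> z"] that by simp
  qed
  ultimately show "\<exists>D. eventually D V \<and> (\<forall>x\<in>Y. \<forall>y\<in>Y. \<forall>z\<in>Y. D (x, y) \<longrightarrow> D (y, z) \<longrightarrow> E (x, z))" by blast
qed

lemma topspace_Z [simp]: "topspace Z = Y"
  by (rule topspace_uniform_topology[OF uniform_structure_V])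

lemma openin_Z: "openin Z A \<longleftrightarrow> A \<subseteq> Y \<and> (\<forall>p\<in>K. \<iota> p \<in> A \<longrightarrow> (\<exists>r>0. \<forall>q\<in>K. dist p q < r \<longrightarrow> \<iota> q \<in> A))"
proof -
  have ev: "eventually (\<lambda>(x', y). x' = \<iota> p \<longrightarrow> y \<in> A) V \<longleftrightarrow> (\<exists>r>0. \<forall>q\<in>K. dist p q < r \<longrightarrow> \<iota> q \<in> A)"
    if "p \<in> K" for p
    unfolding eventually_V using that by (auto simp: \<iota>_eq_iff)
  have "(\<forall>x\<in>A. P x) \<longleftrightarrow> (\<forall>p\<in>K. \<iota> p \<in> A \<longrightarrow> P (\<iota> p))" if "A \<subseteq> Y" for P
    using that by (auto simp: Y_def)
  then show ?thesis unfolding openin_uniform_topology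
    by (intro conj_cong refl) (simp only: ev cong: ball_cong)
qed

lemma homeomorphic_map_\<iota>: "homeomorphic_map (top_of_set K) Z \<iota>"
proof (rule bijective_open_imp_homeomorphic_map)
  show "continuous_map (top_of_set K) Z \<iota>"
    unfolding continuous_map_def
  proof (intro conjI allI impI)
    fix U assume U: "openin Z U"
    show "openin (top_of_set K) {x \<in> topspace (top_of_set K). \<iota> x \<in> U}"
      unfolding openin_euclidean_subtopology_iff using U by (auto simp: openin_Z dist_commute)
  qed auto
  show "open_map (top_of_set K) Z \<iota>"
    unfolding open_map_def
  proof (intro allI impI)
    fix U assume "openin (top_of_set K) U"
    then have U: "U \<subseteq> K" "\<And>x. x \<in> U \<Longrightarrow> \<exists>r>0. \<forall>y\<in>K. dist y x < r \<longrightarrow> y \<in> U"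
      unfolding openin_euclidean_subtopology_iff by auto
    have "\<iota> q \<in> \<iota> ` U \<longleftrightarrow> q \<in> U" if "q \<in> K" for q using U(1) that by (auto simp: \<iota>_eq_iff)
    then show "openin Z (\<iota> ` U)" using U by (auto simp: openin_Z dist_commute)
  qed
qed (simp_all add: inj_\<iota> Y_def[symmetric])

lemma compact_space_Z: "compact_space Z"
  using homeomorphic_map_imp_homeomorphic_space[OF homeomorphic_map_\<iota>] homeomorphic_compact_space
    compact_K compact_space_subtopology compactin_euclidean_iff by blast

lemma Hausdorff_space_Z: "Hausdorff_space Z"
  using homeomorphic_map_imp_homeomorphic_space[OF homeomorphic_map_\<iota>] homeomorphic_Hausdorff_space
    Hausdorff_space_subtopology Hausdorff_space_euclidean by blast

lemma complete_structure_V: "complete_structure Y V"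
  unfolding complete_structure_def
proof (intro allI impI)
  fix F assume F: "F \<noteq> bot" "F \<le> principal Y" "F \<times>\<^sub>F F \<le> V"
  define F' where "F' = filtermap \<kappa> F"
  have FY: "eventually (\<lambda>x. x \<in> Y) F" using F(2) by (simp add: le_principal)
  have "F' \<le> principal K"
    unfolding le_principal F'_def eventually_filtermap using FY by eventually_elim simp
  moreover have "F' \<noteq> bot" using F(1) by (simp add: F'_def filtermap_bot_iff)
  moreover have "cauchy_filter F'"
    unfolding cauchy_filter_def
  proof (rule filter_leI)
    fix P :: "'m \<times> 'm \<Rightarrow> bool" assume "eventually P uniformity"
    then obtain r where "r > 0" "\<And>x y. dist x y < r \<Longrightarrow> P (x, y)"
      unfolding eventually_uniformity_metric by blast
    then have "eventually (\<lambda>(x, y). P (\<kappa> x, \<kappa> y)) V" unfolding eventually_V by auto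
    then have "eventually (\<lambda>(x, y). P (\<kappa> x, \<kappa> y)) (F \<times>\<^sub>F F)" using F(3) by (simp add: le_filter_def)
    then obtain Q where Q: "eventually Q F" "\<And>x y. Q x \<Longrightarrow> Q y \<Longrightarrow> P (\<kappa> x, \<kappa> y)"
      unfolding eventually_prod_same by auto
    have "eventually (\<lambda>x. \<exists>x'. Q x' \<and> \<kappa> x' = \<kappa> x) F" using Q(1) by eventually_elim auto
    then show "eventually P (F' \<times>\<^sub>F F')"
      unfolding F'_def eventually_prod_same eventually_filtermap
      by (intro exI[of _ "\<lambda>p. \<exists>x. Q x \<and> \<kappa> x = p"]) (auto intro: Q(2))
  qed
  ultimately obtain p where p: "p \<in> K" "F' \<le> nhds p"
    using compact_imp_complete[OF compact_K] unfolding complete_uniform by blast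
  have "F \<le> nhdsin Z (\<iota> p)"
  proof (rule filter_leI)
    fix P assume "eventually P (nhdsin Z (\<iota> p))"
    then obtain A where A: "openin Z A" "\<iota> p \<in> A" "\<And>x. x \<in> A \<Longrightarrow> P x"
      using p(1) by (auto simp: eventually_nhdsin)
    then obtain r where r: "r > 0" "\<And>q. q \<in> K \<Longrightarrow> dist p q < r \<Longrightarrow> \<iota> q \<in> A"
      using p(1) unfolding openin_Z by blast
    have "eventually (\<lambda>q. dist q p < r) F'"
      by (rule filter_leD[OF p(2)]) (use r(1) in \<open>auto simp: eventually_nhds_metric\<close>)
    then have "eventually (\<lambda>y. dist (\<kappa> y) p < r) F" by (simp add: F'_def eventually_filtermap)
    with FY show "eventually P F"
    proof eventually_elim
      case (elim y)
      then have "\<iota> (\<kappa> y) \<in> A" by (intro r(2)) (auto simp: dist_commute)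
      then show ?case using elim A(3) by simp
    qed
  qed
  then show "\<exists>x\<in>Y. F \<le> nhdsin Z x" using p(1) by auto
qed

lemma metrizable_structure_V: "metrizable_structure Y V"
  unfolding metrizable_structure_def
proof (intro exI conjI)
  show "Metric_space Y (\<lambda>x y. dist (\<kappa> x) (\<kappa> y))"
  proof
    show "dist (\<kappa> x) (\<kappa> y) = 0 \<longleftrightarrow> x = y" if "x \<in> Y" "y \<in> Y" for x y
      using that by (metis \<iota>_\<kappa> dist_eq_0_iff)
  qed (auto simp: dist_commute dist_triangle)
  have "map_prod \<iota> \<iota> ` {(p, q). p \<in> K \<and> q \<in> K \<and> dist p q < r} =
      {(x, y). x \<in> Y \<and> y \<in> Y \<and> dist (\<kappa> x) (\<kappa> y) < r}" for r
    by (force simp: Y_def)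
  then show "V = (INF r\<in>{0<..}. principal {(x, y). x \<in> Y \<and> y \<in> Y \<and> dist (\<kappa> x) (\<kappa> y) < r})"
    unfolding V_def by simp
qed

text \<open>Supplies the pseudo-metrics that test chains in the copy: being uniformly small near the
  diagonal of \<open>K\<close> puts them into its gage.\<close>

lemma gage_V:
  assumes "\<And>p. d p p = 0" "\<And>p q. 0 \<le> d p q" "\<And>p q. d p q = d q p" "\<And>p q r. d p r \<le> d p q + d q r"
    and "\<And>e. e > 0 \<Longrightarrow> \<exists>\<eta>>0. \<forall>p\<in>K. \<forall>q\<in>K. dist p q < \<eta> \<longrightarrow> d p q < e"
    and "\<And>p q. p \<in> K \<Longrightarrow> q \<in> K \<Longrightarrow> d p q \<le> B"
  shows "(\<lambda>x y. d (\<kappa> x) (\<kappa> y)) \<in> gage Y V"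
  unfolding gage_def bounded_pseudometric_def eventually_V
proof (intro CollectI conjI ballI allI impI)
  show "\<exists>B. \<forall>x\<in>Y. \<forall>y\<in>Y. d (\<kappa> x) (\<kappa> y) \<le> B"
    by (intro exI[of _ B] ballI assms(6) \<kappa>_in)
  show "\<exists>r>0. \<forall>p\<in>K. \<forall>q\<in>K. dist p q < r \<longrightarrow> (case (\<iota> p, \<iota> q) of (x, y) \<Rightarrow> d (\<kappa> x) (\<kappa> y) < e)"
    if "e > 0" for e using assms(5)[OF that] by simp
qed (rule assms)+

lemma homeomorphic_maps_\<iota>_\<kappa>: "homeomorphic_maps (top_of_set K) Z \<iota> \<kappa>"
proof -
  obtain g where g: "homeomorphic_maps (top_of_set K) Z \<iota> g"
    using homeomorphic_map_\<iota> unfolding homeomorphic_map_maps by blast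
  then have "g (\<iota> p) = p" if "p \<in> K" for p
    using that unfolding homeomorphic_maps_def by simp
  then have "g y = \<kappa> y" if "y \<in> topspace Z" for y
    using that \<iota>_\<kappa> \<kappa>_in by (metis topspace_Z)
  then show ?thesis by (intro homeomorphic_maps_eq[OF g]) simp_all
qed

lemma continuous_map_\<kappa>: "continuous_map Z (top_of_set K) \<kappa>"
  using homeomorphic_maps_\<iota>_\<kappa> by (simp add: homeomorphic_maps_def)

lemma homeomorphic_map_prod_\<iota>:
  "homeomorphic_map (top_of_set (K \<times> K)) (prod_topology Z Z) (map_prod \<iota> \<iota>)"
proof -
  have "homeomorphic_maps (prod_topology (top_of_set K) (top_of_set K)) (prod_topology Z Z)
      (\<lambda>(x, y). (\<iota> x, \<iota> y)) (\<lambda>(x, y). (\<kappa> x, \<kappa> y))"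
    using homeomorphic_maps_\<iota>_\<kappa> homeomorphic_maps_prod by blast
  then show ?thesis
    unfolding homeomorphic_map_maps map_prod_def by auto
qed

text \<open>If a closed transitive \<open>G'\<close> containing \<open>R\<close> misses
  \<open>(x, y)\<close>, the separating function \<open>L\<close> never increases along edges, a
  jump raises it by at most its cost, and the first edge already ends where \<open>L < 1/2\<close>.
  A chain of total cost below \<open>1/2\<close> therefore cannot reach \<open>y\<close>, where
  \<open>L\<close> is \<open>1\<close>.\<close>

lemma A_rel_subset_G_rel:
  assumes "R \<subseteq> Y \<times> Y"
  shows "A_rel Y V R \<subseteq> G_rel Z R"
proof (rule subrelI)
  fix x y assume A: "(x, y) \<in> A_rel Y V R"
  then have xy: "x \<in> Y" "y \<in> Y" by (auto simp: A_rel_def)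
  show "(x, y) \<in> G_rel Z R"
    unfolding G_rel_def
  proof (rule InterI, clarify, rule ccontr)
    fix G' assume clo: "closedin (prod_topology Z Z) G'" and tr: "trans G'" and R: "R \<subseteq> G'"
      and no: "(x, y) \<notin> G'"
    define G where "G = {r \<in> K \<times> K. map_prod \<iota> \<iota> r \<in> G'}"
    from closedin_continuous_map_preimage[OF homeomorphic_imp_continuous_map[OF homeomorphic_map_prod_\<iota>] clo]
    have "closedin (top_of_set (K \<times> K)) G" by (simp add: G_def)
    moreover have "closed (K \<times> K)" using compact_K compact_imp_closed closed_Times by blast
    ultimately have "closed G" using closedin_closed_trans by blast
    moreover have "G \<subseteq> K \<times> K" by (auto simp: G_def)
    moreover have "trans G" using tr unfolding trans_def G_def by auto
    moreover have "\<kappa> x \<in> K" "\<kappa> y \<in> K" "(\<kappa> x, \<kappa> y) \<notin> G" using xy no by (auto simp: G_def)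
    ultimately obtain L \<delta> where L: "\<And>p. L p \<in> {0..1::real}"
      "\<And>e. e > 0 \<Longrightarrow> \<exists>\<eta>>0. \<forall>p\<in>K. \<forall>q\<in>K. dist p q < \<eta> \<longrightarrow> \<bar>L p - L q\<bar> < e"
      "\<And>p q. (p, q) \<in> G \<Longrightarrow> L q \<le> L p" "L (\<kappa> y) = 1"
      "\<delta> > 0" "\<And>p q. (p, q) \<in> G \<Longrightarrow> dist (\<kappa> x) p < \<delta> \<Longrightarrow> L q < 1/2"
      by (rule compact_preorder_separation[OF compact_K]) (rule that; assumption)
    \<comment> \<open>The term with \<open>L\<close> pays for increases of \<open>L\<close>, the
      term \<open>dist\<close> keeps the first edge close to \<open>x\<close>. Both sit in one
      pseudo-metric because \<open>A_rel\<close> yields a chain for one pseudo-metric at a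
      time.\<close>
    define d where "d p q = \<bar>L p - L q\<bar> + dist p q" for p q
    define D where "D = (\<lambda>x y. d (\<kappa> x) (\<kappa> y))"
    obtain B where B: "\<And>p q. p \<in> K \<Longrightarrow> q \<in> K \<Longrightarrow> dist p q \<le> B"
      using compact_imp_bounded[OF compact_K] unfolding bounded_two_points by blast
    have "D \<in> gage Y V"
      unfolding D_def
    proof (rule gage_V)
      show "d p r \<le> d p q + d q r" for p q r
        unfolding d_def using dist_triangle[of p r q] by linarith
      show "d p q \<le> 1 + B" if "p \<in> K" "q \<in> K" for p q
        using B[OF that] L(1)[of p] L(1)[of q] by (auto simp: d_def abs_real_def)
      show "\<exists>\<eta>>0. \<forall>p\<in>K. \<forall>q\<in>K. dist p q < \<eta> \<longrightarrow> d p q < e" if "e > 0" for e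
      proof -
        have "e/2 > 0" using that by simp
        from L(2)[OF this] obtain \<eta> where "\<eta> > 0" "\<forall>p\<in>K. \<forall>q\<in>K. dist p q < \<eta> \<longrightarrow> \<bar>L p - L q\<bar> < e/2" by blast
        then show ?thesis unfolding d_def using \<open>e/2 > 0\<close> by (intro exI[of _ "min \<eta> (e/2)"]) fastforce
      qed
    qed (auto simp: d_def dist_commute)
    moreover have "min \<delta> (1/2) > 0" using L(5) by simp
    ultimately obtain n a b where n: "n \<ge> 1" and ab: "\<forall>i\<in>{1..n}. (a i, b i) \<in> R"
      and sum: "D x (a 1) + (\<Sum>i = 1..<n. D (b i) (a (Suc i))) + D (b n) y < min \<delta> (1/2)"
      using A unfolding A_rel_def by blast
    have abG: "(\<kappa> (a i), \<kappa> (b i)) \<in> G" if "i \<in> {1..n}" for i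
      using ab that R assms by (force simp: G_def)
    have Dpos: "0 \<le> D u v" and DL: "\<bar>L (\<kappa> u) - L (\<kappa> v)\<bar> \<le> D u v" and Dd: "dist (\<kappa> u) (\<kappa> v) \<le> D u v" for u v
      by (auto simp: D_def d_def)
    have sum0: "0 \<le> (\<Sum>i = 1..<n. D (b i) (a (Suc i)))" by (simp add: sum_nonneg Dpos)
    have "dist (\<kappa> x) (\<kappa> (a 1)) < \<delta>"
      using Dd[of x "a 1"] sum sum0 Dpos[of "b n" y] by linarith
    then have b1: "L (\<kappa> (b 1)) < 1/2" using L(6) abG[of 1] n by simp
    \<comment> \<open>The count starts at \<open>b 1\<close>, after the first edge, as
      \<open>L\<close> need not be small at \<open>x\<close> itself.\<close>
    have "L (\<kappa> (b k)) \<le> L (\<kappa> (b 1)) + (\<Sum>i = 1..<k. D (b i) (a (Suc i)))" if "1 \<le> k" "k \<le> n" for k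
      using that
    proof (induction k rule: dec_induct)
      case (step k)
      have "L (\<kappa> (b (Suc k))) \<le> L (\<kappa> (a (Suc k)))" using L(3) abG[of "Suc k"] step by simp
      then show ?case using step DL[of "b k" "a (Suc k)"] by simp
    qed simp
    from this[OF n order_refl] have "L (\<kappa> y) < 1"
      using sum b1 DL[of "b n" y] Dpos[of x "a 1"] min.cobounded2[of \<delta> "1/2"] by linarith
    then show False using L(4) by simp
  qed
qed

end

section \<open>The compactification given by a countable family of functions\<close>

lemma continuous_on_pair_coordinates:
  "continuous_on UNIV (\<lambda>r :: (nat \<Rightarrow> real) \<times> (nat \<Rightarrow> real). fst r m)"
  "continuous_on UNIV (\<lambda>r :: (nat \<Rightarrow> real) \<times> (nat \<Rightarrow> real). snd r m)"
  by (rule continuous_on_product_then_coordinatewise,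
      intro continuous_on_fst continuous_on_snd continuous_on_id)+

text \<open>The separation condition makes the evaluation map an embedding: a single coordinate
  isolates a point from the complement of a neighbourhood.\<close>

locale coordinate_family =
  fixes \<phi> :: "nat \<Rightarrow> 'a::{uniform_space, t2_space} \<Rightarrow> real"
  assumes uniformly_continuous_\<phi>: "\<And>n. uniformly_continuous_on UNIV (\<phi> n)"
    and \<phi>_bounds: "\<And>n x. \<phi> n x \<in> {0..1}"
    and \<phi>_separates: "\<And>A x. open A \<Longrightarrow> x \<in> A \<Longrightarrow> \<exists>n. \<exists>\<delta>>0. \<forall>y. \<bar>\<phi> n x - \<phi> n y\<bar> < \<delta> \<longrightarrow> y \<in> A"
begin

definition e :: "'a \<Rightarrow> nat \<Rightarrow> real" where "e x = (\<lambda>n. \<phi> n x)"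

definition K :: "(nat \<Rightarrow> real) set" where "K = closure (range e)"

definition \<iota> :: "(nat \<Rightarrow> real) \<Rightarrow> 'a filter" where "\<iota> p = filtercomap e (nhds p)"

lemma e_in_K [simp]: "e x \<in> K"
  unfolding K_def by (rule subsetD[OF closure_subset rangeI])

text \<open>The density principle behind the extensions: inequalities between coordinates and
  identities of continuous maps are closed conditions, so it is enough to know them on
  \<open>X\<close>.\<close>

lemma K_induct:
  assumes "p \<in> K" "closed C" "\<And>x. e x \<in> C"
  shows "p \<in> C"
proof -
  have "range e \<subseteq> C" using assms(3) by auto
  then have "closure (range e) \<subseteq> C" using assms(2) by (rule closure_minimal)
  then show ?thesis using assms(1) by (auto simp: K_def)
qed

lemma closed_le_coordinate: "closed {p :: nat \<Rightarrow> real. p m \<le> p n}" "closed {p :: nat \<Rightarrow> real. p n \<le> c}"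
    "closed {p :: nat \<Rightarrow> real. c \<le> p n}"
  by (intro closed_Collect_le continuous_on_const continuous_on_product_coordinates)+

lemma K_bounds: "p \<in> K \<Longrightarrow> 0 \<le> p n" "p \<in> K \<Longrightarrow> p n \<le> 1"
  using K_induct[OF _ closed_le_coordinate(3), of p 0 n] K_induct[OF _ closed_le_coordinate(2), of p n 1] \<phi>_bounds
  by (auto simp: e_def)

lemma compact_K: "compact K"
proof -
  have "compactin (product_topology (\<lambda>_. euclidean) UNIV) (PiE UNIV (\<lambda>_::nat. {0..1::real}))"
    unfolding compactin_PiE by simp
  then have "compact (PiE UNIV (\<lambda>_::nat. {0..1::real}))"
    by (simp add: euclidean_product_topology)
  moreover have "K \<subseteq> PiE UNIV (\<lambda>_::nat. {0..1::real})" using K_bounds by auto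
  moreover have "closed K" by (simp add: K_def)
  ultimately show ?thesis by (metis compact_Int_closed inf.absorb2)
qed

text \<open>Disjoint neighbourhoods of \<open>p\<close> and \<open>q\<close> would have traces in
  one filter and make it improper; but every neighbourhood of a point of \<open>K\<close> meets the
  image of \<open>X\<close>.\<close>

lemma inj_\<iota>: "inj_on \<iota> K"
proof (rule inj_onI, rule ccontr)
  fix p q assume pq: "p \<in> K" "q \<in> K" "\<iota> p = \<iota> q" "p \<noteq> q"
  from hausdorff[OF pq(4)] obtain U W where U: "open U" "open W" "p \<in> U" "q \<in> W" "U \<inter> W = {}" by blast
  have "eventually (\<lambda>x. e x \<in> U) (\<iota> p)" "eventually (\<lambda>x. e x \<in> W) (\<iota> q)"
    unfolding \<iota>_def using U by (auto intro!: eventually_filtercomapI eventually_nhds_in_open)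
  then have "eventually (\<lambda>x. e x \<in> U \<and> e x \<in> W) (\<iota> p)" using pq(3) by (simp add: eventually_conj)
  then have "eventually (\<lambda>x. False) (\<iota> p)" by (rule eventually_mono) (use U(5) in blast)
  then obtain P where P: "eventually P (nhds p)" "\<And>x. \<not> P (e x)"
    unfolding \<iota>_def eventually_filtercomap by auto
  then obtain O' where "open O'" "p \<in> O'" "\<And>z. z \<in> O' \<Longrightarrow> P z" unfolding eventually_nhds by blast
  then have "O' \<inter> range e = {}" using P(2) by blast
  then show False using pq(1) \<open>open O'\<close> \<open>p \<in> O'\<close> unfolding K_def
    by (metis IntI emptyE open_Int_closure_eq_empty)
qed

sublocale compact_metric_copy K \<iota>
  by unfold_locales (rule compact_K, rule inj_\<iota>)

definition i :: "'a \<Rightarrow> 'a filter" where "i x = \<iota> (e x)"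

definition T :: "('a \<times> 'a) filter" where "T = filtercomap (map_prod i i) V"

lemma i_in [simp]: "i x \<in> Y" and \<kappa>_i [simp]: "\<kappa> (i x) = e x"
  by (simp_all add: i_def)

lemma coordinate_near:
  assumes "r > 0"
  shows "\<exists>\<eta>>0. \<forall>p\<in>K. \<forall>q\<in>K. dist p q < \<eta> \<longrightarrow> \<bar>p n - q n\<bar> < r"
proof -
  have "uniformly_continuous_on K (\<lambda>p. p n)"
    by (rule compact_uniformly_continuous[OF _ compact_K])
       (rule continuous_on_subset[OF continuous_on_product_coordinates], simp)
  then show ?thesis using assms unfolding uniformly_continuous_on_def dist_real_def
    by (metis abs_minus_commute dist_commute)
qed

lemma separation_e:
  assumes "open A" "x \<in> A"
  shows "\<exists>r>0. \<forall>y. dist (e x) (e y) < r \<longrightarrow> y \<in> A"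
proof -
  obtain n \<delta> where n: "\<delta> > 0" "\<And>y. \<bar>\<phi> n x - \<phi> n y\<bar> < \<delta> \<Longrightarrow> y \<in> A"
    using \<phi>_separates[OF assms] by blast
  obtain \<eta> where "\<eta> > 0" "\<And>p q. p \<in> K \<Longrightarrow> q \<in> K \<Longrightarrow> dist p q < \<eta> \<Longrightarrow> \<bar>p n - q n\<bar> < \<delta>"
    using coordinate_near[OF n(1)] by blast
  then show ?thesis using n(2) e_in_K by (intro exI[of _ \<eta>]) (auto simp: e_def)
qed

lemma inj_e: "inj e"
proof (rule injI, rule ccontr)
  fix x y assume xy: "e x = e y" "x \<noteq> y"
  from hausdorff[OF xy(2)] obtain U where "open U" "x \<in> U" "y \<notin> U" by blast
  then show False using separation_e[of U x] xy(1) by auto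
qed

lemma inj_i: "inj i"
  using inj_e \<kappa>_i by (metis injD injI)

lemma e_uniform:
  assumes "r > 0"
  shows "eventually (\<lambda>(x, y). dist (e x) (e y) < r) uniformity"
proof -
  \<comment> \<open>The budget is \<open>r/2 + r/2\<close>: the product metric is at most twice the
    largest distance over the first \<open>N + 1\<close> coordinates, in the enumeration
    \<open>from_nat\<close>, plus a tail of \<open>(1/2) ^ N\<close>.\<close>
  obtain N where N: "(1/2) ^ N < r / 2"
    using real_arch_pow_inv[of "r/2" "1/2"] assms by auto
  have "eventually (\<lambda>z. \<forall>n\<in>{..N}. \<bar>\<phi> (from_nat n) (fst z) - \<phi> (from_nat n) (snd z)\<bar> < r / 4) uniformity"
  proof (intro eventually_ball_finite ballI)
    have "r / 4 > 0" using assms by simp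
    then show "eventually (\<lambda>z. \<bar>\<phi> (from_nat n) (fst z) - \<phi> (from_nat n) (snd z)\<bar> < r / 4) uniformity" for n
      using uniformly_continuous_\<phi>[of "from_nat n"]
      unfolding uniformly_continuous_on_UNIV_real_iff case_prod_beta' by blast
  qed simp
  then show ?thesis
  proof eventually_elim
    case (elim z)
    obtain x y where z: "z = (x, y)" by fastforce
    have "Max {dist (e x (from_nat n)) (e y (from_nat n)) |n. n \<le> N} < r / 4"
    proof (subst Max_less_iff)
      have "{dist (e x (from_nat n)) (e y (from_nat n)) |n. n \<le> N} =
          (\<lambda>n. dist (e x (from_nat n)) (e y (from_nat n))) ` {..N}" by auto
      then show "finite {dist (e x (from_nat n)) (e y (from_nat n)) |n. n \<le> N}" by simp
    qed (use elim z in \<open>auto simp: e_def dist_real_def\<close>)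
    then show ?case using dist_fun_le_dist_first_terms[of "e x" "e y" N] N z by simp
  qed
qed

lemma eventually_T: "eventually P T \<longleftrightarrow> (\<exists>r>0. \<forall>x y. dist (e x) (e y) < r \<longrightarrow> P (x, y))"
proof
  assume "eventually P T"
  then obtain Q where Q: "eventually Q V" "\<And>x y. Q (i x, i y) \<Longrightarrow> P (x, y)"
    unfolding T_def eventually_filtercomap by auto
  then show "\<exists>r>0. \<forall>x y. dist (e x) (e y) < r \<longrightarrow> P (x, y)"
    unfolding eventually_V i_def by (metis e_in_K)
next
  assume "\<exists>r>0. \<forall>x y. dist (e x) (e y) < r \<longrightarrow> P (x, y)"
  then obtain r where r: "r > 0" "\<And>x y. dist (e x) (e y) < r \<Longrightarrow> P (x, y)" by blast
  have "eventually (\<lambda>(u, v). dist (\<kappa> u) (\<kappa> v) < r) V"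
    unfolding eventually_V using r(1) by (intro exI[of _ r]) auto
  then show "eventually P T"
    unfolding T_def eventually_filtercomap
    by (intro exI[of _ "\<lambda>(u, v). dist (\<kappa> u) (\<kappa> v) < r"]) (auto intro: r(2))
qed

lemma uniformity_le_T: "uniformity \<le> T"
proof (rule filter_leI)
  fix P assume "eventually P T"
  then obtain r where r: "r > 0" "\<And>x y. dist (e x) (e y) < r \<Longrightarrow> P (x, y)" unfolding eventually_T by blast
  from e_uniform[OF r(1)] show "eventually P uniformity"
    by eventually_elim (use r(2) in auto)
qed

lemma uniform_structure_T: "uniform_structure UNIV T"
  unfolding uniform_structure_def
proof (intro conjI allI impI ballI)
  fix E assume "eventually E T"
  then obtain r where r: "r > 0" "\<And>x y. dist (e x) (e y) < r \<Longrightarrow> E (x, y)" unfolding eventually_T by blast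
  show "E (x, x)" for x using r by simp
  show "eventually (\<lambda>(x, y). E (y, x)) T"
    unfolding eventually_T using r by (auto simp: dist_commute)
  have "eventually (\<lambda>(x, y). dist (e x) (e y) < r / 2) T"
    unfolding eventually_T using r(1) by (intro exI[of _ "r/2"]) auto
  moreover have "E (x, z)" if "dist (e x) (e y) < r / 2" "dist (e y) (e z) < r / 2" for x y z
    using dist_triangle_half_l[of "e x" "e y" r "e z"] that by (intro r(2)) (simp add: dist_commute)
  ultimately show "\<exists>D. eventually D T \<and> (\<forall>x\<in>UNIV. \<forall>y\<in>UNIV. \<forall>z\<in>UNIV. D (x, y) \<longrightarrow> D (y, z) \<longrightarrow> E (x, z))"
    by (intro exI[of _ "\<lambda>(x, y). dist (e x) (e y) < r / 2"]) auto
qed simp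

lemma totally_bounded_T: "totally_bounded_structure UNIV T"
  unfolding totally_bounded_structure_def
proof (intro allI impI)
  fix E assume "eventually E T"
  then obtain r where r: "r > 0" "\<And>x y. dist (e x) (e y) < r \<Longrightarrow> E (x, y)" unfolding eventually_T by blast
  have "K \<subseteq> (\<Union>x\<in>UNIV. ball (e x) r)"
  proof
    fix p assume "p \<in> K"
    then obtain x where "dist (e x) p < r" using r(1) unfolding K_def closure_approachable by blast
    then show "p \<in> (\<Union>x\<in>UNIV. ball (e x) r)" by auto
  qed
  then obtain F where F: "finite F" "K \<subseteq> (\<Union>x\<in>F. ball (e x) r)"
    using compactE_image[OF compact_K, of UNIV "\<lambda>x. ball (e x) r"] by auto
  have "\<exists>x\<in>F. E (x, y)" for y
  proof -
    have "e y \<in> (\<Union>x\<in>F. ball (e x) r)" using F(2) e_in_K by blast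
    then show ?thesis using r(2) by auto
  qed
  then show "\<exists>F. finite F \<and> F \<subseteq> UNIV \<and> (\<forall>y\<in>UNIV. \<exists>x\<in>F. E (x, y))" using F(1) by auto
qed

lemma uniform_topology_T: "uniform_topology UNIV T = euclidean"
proof (rule topology_eq[THEN iffD2], rule allI)
  fix A :: "'a set"
  have "openin (uniform_topology UNIV T) A \<longleftrightarrow> (\<forall>x\<in>A. \<exists>r>0. \<forall>y. dist (e x) (e y) < r \<longrightarrow> y \<in> A)"
    unfolding openin_uniform_topology eventually_T by auto
  also have "\<dots> \<longleftrightarrow> open A"
  proof
    assume *: "\<forall>x\<in>A. \<exists>r>0. \<forall>y. dist (e x) (e y) < r \<longrightarrow> y \<in> A"
    show "open A"
      unfolding open_uniformity
    proof
      fix x assume "x \<in> A"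
      with * obtain r where r: "r > 0" "\<And>y. dist (e x) (e y) < r \<Longrightarrow> y \<in> A" by blast
      from e_uniform[OF r(1)] show "eventually (\<lambda>(x', y). x' = x \<longrightarrow> y \<in> A) uniformity"
        by eventually_elim (use r(2) in auto)
    qed
  qed (use separation_e in blast)
  finally show "openin (uniform_topology UNIV T) A = openin euclidean A" by simp
qed

lemma is_completion_i: "is_completion T Y V i"
  unfolding is_completion_def
proof (intro conjI uniform_structure_V Hausdorff_space_Z complete_structure_V inj_i)
  show "range i \<subseteq> Y" by auto
  show "T = filtercomap (map_prod i i) V" by (simp add: T_def)
  have "Z closure_of (\<iota> ` range e) = \<iota> ` (top_of_set K closure_of range e)"
    by (rule homeomorphic_map_closure_of[OF homeomorphic_map_\<iota>]) auto
  also have "top_of_set K closure_of range e = K"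
    unfolding closure_of_subtopology by (auto simp: K_def closure_of_subtopology Int_absorb1 closure_subset)
  finally show "Z closure_of range i = Y" by (simp add: Y_def i_def[abs_def] image_image)
qed

section \<open>The closure of the relation in the compactification\<close>

definition fbar :: "('a \<times> 'a) set \<Rightarrow> ('a filter \<times> 'a filter) set" where
  "fbar f = prod_topology Z Z closure_of (map_prod i i ` f)"

lemma closure_sub: "closure (map_prod e e ` f) \<subseteq> K \<times> K"
proof (rule closure_minimal)
  show "closed (K \<times> K)" by (simp add: K_def closed_Times)
qed auto

lemma fbar_eq: "fbar f = map_prod \<iota> \<iota> ` closure (map_prod e e ` f)"
proof -
  have sub: "map_prod e e ` f \<subseteq> K \<times> K" by auto
  have "fbar f = map_prod \<iota> \<iota> ` (top_of_set (K \<times> K) closure_of (map_prod e e ` f))"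
    unfolding fbar_def using homeomorphic_map_closure_of[OF homeomorphic_map_prod_\<iota>, of "map_prod e e ` f"] sub
    by (simp add: image_image i_def map_prod_def split_beta)
  then show ?thesis using sub closure_sub[of f] by (simp add: closure_of_subtopology Int_absorb1)
qed

lemma fbar_sub: "fbar f \<subseteq> Y \<times> Y"
  unfolding fbar_eq using closure_sub[of f] by auto

lemma in_fbar: "(a, b) \<in> f \<Longrightarrow> (i a, i b) \<in> fbar f"
  unfolding fbar_eq using closure_subset[of "map_prod e e ` f"] by (force simp: i_def)

text \<open>The density principle for edges instead of points.\<close>

lemma fbar_closed_prop:
  assumes "closed C" "\<And>a b. (a, b) \<in> f \<Longrightarrow> (e a, e b) \<in> C" "(u, v) \<in> fbar f"
  shows "(\<kappa> u, \<kappa> v) \<in> C"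
proof -
  obtain p q where pq: "(p, q) \<in> closure (map_prod e e ` f)" "u = \<iota> p" "v = \<iota> q"
    using assms(3) unfolding fbar_eq by auto
  moreover have "closure (map_prod e e ` f) \<subseteq> C" by (rule closure_minimal) (use assms in auto)
  moreover have "p \<in> K" "q \<in> K" using pq(1) closure_sub[of f] by auto
  ultimately show ?thesis by auto
qed

lemma fbar_restrict:
  assumes "closed f"
  shows "map_prod i i -` fbar f = f"
proof
  show "f \<subseteq> map_prod i i -` fbar f" using in_fbar by auto
  show "map_prod i i -` fbar f \<subseteq> f"
  proof (clarsimp, rule ccontr)
    fix x y assume xy: "(i x, i y) \<in> fbar f" "(x, y) \<notin> f"
    from assms have "open (- f)" by (simp add: open_Compl)
    moreover have "(x, y) \<in> - f" using xy(2) by simp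
    ultimately obtain A B where "open A" "open B" "(x, y) \<in> A \<times> B" and sub: "A \<times> B \<subseteq> - f"
      by (rule open_prod_elim)
    then have AB: "open A" "open B" "x \<in> A" "y \<in> B" by auto
    obtain r where r: "r > 0" "\<And>z. dist (e x) (e z) < r \<Longrightarrow> z \<in> A" using separation_e[OF AB(1,3)] by blast
    obtain s where s: "s > 0" "\<And>z. dist (e y) (e z) < s \<Longrightarrow> z \<in> B" using separation_e[OF AB(2,4)] by blast
    have "(\<kappa> (i x), \<kappa> (i y)) \<in> - (ball (e x) r \<times> ball (e y) s)"
    proof (rule fbar_closed_prop[OF _ _ xy(1)])
      show "closed (- (ball (e x) r \<times> ball (e y) s))" by (intro closed_Compl open_Times open_ball)
      show "(e a, e b) \<in> - (ball (e x) r \<times> ball (e y) s)" if "(a, b) \<in> f" for a b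
        using that sub r(2)[of a] s(2)[of b] by auto
    qed
    then show False using r s by simp
  qed
qed

text \<open>\<open>T\<close> is coarser than the given uniformity, so every pseudo-metric of the
  compactification restricts to one of the original gage. Chains found on \<open>X\<close> thus
  survive in the compactification.\<close>

lemma gage_pullback:
  assumes "d \<in> gage Y V"
  shows "(\<lambda>x y. d (i x) (i y)) \<in> gage UNIV uniformity"
  unfolding gage_def
proof (intro CollectI conjI allI impI)
  show "bounded_pseudometric UNIV (\<lambda>x y. d (i x) (i y))"
  proof -
    have d: "bounded_pseudometric Y d" using assms by (simp add: gage_def)
    then obtain B where "\<forall>x\<in>Y. \<forall>y\<in>Y. d x y \<le> B" unfolding bounded_pseudometric_def by blast
    then show ?thesis using d unfolding bounded_pseudometric_def by (auto intro!: exI[of _ B])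
  qed
  fix r :: real assume "r > 0"
  then have "eventually (\<lambda>(u, v). d u v < r) V" using assms by (simp add: gage_def)
  then have "eventually (\<lambda>(x, y). d (i x) (i y) < r) T"
    unfolding T_def eventually_filtercomap by (intro exI[of _ "\<lambda>(u, v). d u v < r"]) auto
  then show "eventually (\<lambda>(x, y). d (i x) (i y) < r) uniformity"
    by (rule filter_leD[OF uniformity_le_T])
qed

lemma A_rel_i:
  assumes "(x, y) \<in> A_rel UNIV uniformity f"
  shows "(i x, i y) \<in> A_rel Y V (fbar f)"
  unfolding A_rel_def mem_Collect_eq case_prod_conv
proof (intro conjI ballI allI impI i_in)
  fix d r assume d: "d \<in> gage Y V" and r: "(0::real) < r"
  obtain n a b where n: "n \<ge> 1" and ab: "\<And>k. k \<in> {1..n} \<Longrightarrow> (a k, b k) \<in> f"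
    and "d (i x) (i (a 1)) + (\<Sum>k = 1..<n. d (i (b k)) (i (a (Suc k)))) + d (i (b n)) (i y) < r"
    by (rule A_relD[OF assms gage_pullback[OF d] r]) (rule that; assumption)
  then have "(\<forall>k\<in>{1..n}. ((i \<circ> a) k, (i \<circ> b) k) \<in> fbar f) \<and>
      d (i x) ((i \<circ> a) 1) + (\<Sum>k = 1..<n. d ((i \<circ> b) k) ((i \<circ> a) (Suc k))) + d ((i \<circ> b) n) (i y) < r"
    by (simp add: in_fbar)
  with n show "\<exists>n\<ge>1. \<exists>a b. (\<forall>k\<in>{1..n}. (a k, b k) \<in> fbar f) \<and>
      d (i x) (a 1) + (\<Sum>k = 1..<n. d (b k) (a (Suc k))) + d (b n) (i y) < r"
    by - (rule exI[of _ n], rule conjI, assumption, rule exI[of _ "i \<circ> a"], rule exI[of _ "i \<circ> b"])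
qed

lemma C_rel_i:
  assumes "(x, y) \<in> C_rel UNIV uniformity f"
  shows "(i x, i y) \<in> C_rel Y V (fbar f)"
  unfolding C_rel_def mem_Collect_eq case_prod_conv
proof (intro conjI ballI allI impI i_in)
  fix d r assume d: "d \<in> gage Y V" and r: "(0::real) < r"
  obtain n a b where n: "n \<ge> 1" and ab: "\<And>k. k \<in> {1..n} \<Longrightarrow> (a k, b k) \<in> f"
    and "d (i x) (i (a 1)) < r" "\<And>k. k \<in> {1..<n} \<Longrightarrow> d (i (b k)) (i (a (Suc k))) < r" "d (i (b n)) (i y) < r"
    by (rule C_relD[OF assms gage_pullback[OF d] r]) (rule that; assumption)
  then have "(\<forall>k\<in>{1..n}. ((i \<circ> a) k, (i \<circ> b) k) \<in> fbar f) \<and>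
      Max ({d (i x) ((i \<circ> a) 1), d ((i \<circ> b) n) (i y)} \<union> (\<lambda>k. d ((i \<circ> b) k) ((i \<circ> a) (Suc k))) ` {1..<n}) < r"
    by (auto intro: in_fbar)
  with n show "\<exists>n\<ge>1. \<exists>a b. (\<forall>k\<in>{1..n}. (a k, b k) \<in> fbar f) \<and>
      Max ({d (i x) (a 1), d (b n) (i y)} \<union> (\<lambda>k. d (b k) (a (Suc k))) ` {1..<n}) < r"
    by - (rule exI[of _ n], rule conjI, assumption, rule exI[of _ "i \<circ> a"], rule exI[of _ "i \<circ> b"])
qed

text \<open>\<open>{(p, q). q n \<le> p m}\<close> is transitive on \<open>K\<close> because \<open>p m \<le> p n\<close> there.\<close>

lemma G_rel_excluded:
  assumes le: "\<And>z. \<phi> m z \<le> \<phi> n z" and f: "\<And>a b. (a, b) \<in> f \<Longrightarrow> \<phi> n b \<le> \<phi> m a" and xy: "\<phi> m x < \<phi> n y"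
  shows "(i x, i y) \<notin> G_rel Z (fbar f)"
proof
  assume "(i x, i y) \<in> G_rel Z (fbar f)"
  define P where "P = {r :: (nat \<Rightarrow> real) \<times> (nat \<Rightarrow> real). snd r n \<le> fst r m}"
  have P: "closed P"
    unfolding P_def
    by (intro closed_Collect_le continuous_on_pair_coordinates)
  have leK: "p m \<le> p n" if "p \<in> K" for p
    using K_induct[OF that closed_le_coordinate(1), of m n] le by (auto simp: e_def)
  let ?R = "map_prod \<iota> \<iota> ` (K \<times> K \<inter> P)"
  have "closedin (prod_topology Z Z) ?R"
    using homeomorphic_imp_closed_map[OF homeomorphic_map_prod_\<iota>] P unfolding closed_map_def
    by (simp add: closedin_closed_Int)
  moreover have "trans ?R"
  proof (rule transI)
    fix u v w assume "(u, v) \<in> ?R" "(v, w) \<in> ?R"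
    then obtain p q q' r where *: "p \<in> K" "q \<in> K" "q' \<in> K" "r \<in> K" "(p, q) \<in> P" "(q', r) \<in> P"
      "u = \<iota> p" "v = \<iota> q" "v = \<iota> q'" "w = \<iota> r" by auto
    then have "q = q'" by (simp add: \<iota>_eq_iff)
    then have "(p, r) \<in> P" using * leK[of q] by (auto simp: P_def)
    then show "(u, w) \<in> ?R" using * by auto
  qed
  moreover have "fbar f \<subseteq> ?R"
  proof (rule subrelI)
    fix u v assume uv: "(u, v) \<in> fbar f"
    then have "(\<kappa> u, \<kappa> v) \<in> P" using fbar_closed_prop[OF P _ uv] f by (auto simp: P_def e_def)
    moreover have "u \<in> Y" "v \<in> Y" using uv fbar_sub by auto
    ultimately show "(u, v) \<in> ?R" by (intro image_eqI[of _ _ "(\<kappa> u, \<kappa> v)"]) auto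
  qed
  ultimately have "(i x, i y) \<in> ?R" using \<open>(i x, i y) \<in> G_rel Z (fbar f)\<close> unfolding G_rel_def by blast
  then obtain p q where "p \<in> K" "q \<in> K" "(p, q) \<in> P" "i x = \<iota> p" "i y = \<iota> q" by auto
  then have "(e x, e y) \<in> P" by (simp add: i_def \<iota>_eq_iff)
  then show False using xy by (simp add: P_def e_def)
qed

text \<open>Chains are followed directly. With jumps below \<open>1/2\<close>, every edge begins
  where coordinate \<open>m\<close> is below \<open>1\<close> and so ends where coordinate
  \<open>n\<close>, hence also coordinate \<open>m\<close>, is \<open>0\<close>. The error is reset
  at every edge instead of accumulating, as it must be when only the maximum of the jumps is
  small.\<close>

lemma C_rel_excluded:
  assumes le: "\<And>z. \<phi> m z \<le> \<phi> n z" and f: "\<And>a b. (a, b) \<in> f \<Longrightarrow> \<phi> m a < 1 \<Longrightarrow> \<phi> n b = 0"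
    and xy: "\<phi> m x < 1/2" "1/2 < \<phi> n y"
  shows "(i x, i y) \<notin> C_rel Y V (fbar f)"
proof
  assume C: "(i x, i y) \<in> C_rel Y V (fbar f)"
  \<comment> \<open>The implication from \<open>\<phi> m a < 1\<close> to
    \<open>\<phi> n b = 0\<close>, written as a union of two closed sets; \<open>\<le> 0\<close>
    suffices because coordinates on \<open>K\<close> are nonnegative.\<close>
  define P where "P = {r :: (nat \<Rightarrow> real) \<times> (nat \<Rightarrow> real). 1 \<le> fst r m} \<union> {r. snd r n \<le> 0}"
  have P: "closed P"
    unfolding P_def
    by (intro closed_Un closed_Collect_le continuous_on_pair_coordinates continuous_on_const)
  have leK: "p m \<le> p n" if "p \<in> K" for p
    using K_induct[OF that closed_le_coordinate(1), of m n] le by (auto simp: e_def)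
  have fP: "\<kappa> v n = 0" if "(u, v) \<in> fbar f" "\<kappa> u m < 1" for u v
  proof -
    have "(\<kappa> u, \<kappa> v) \<in> P" using fbar_closed_prop[OF P _ that(1)] f by (force simp: P_def e_def)
    moreover have "v \<in> Y" using that(1) fbar_sub by auto
    ultimately show ?thesis using that(2) K_bounds(1)[of "\<kappa> v" n] by (auto simp: P_def)
  qed
  define d where "d p q = \<bar>p m - q m\<bar> + \<bar>p n - q n\<bar>" for p q :: "nat \<Rightarrow> real"
  have "(\<lambda>u v. d (\<kappa> u) (\<kappa> v)) \<in> gage Y V"
  proof (rule gage_V)
    show "\<exists>\<eta>>0. \<forall>p\<in>K. \<forall>q\<in>K. dist p q < \<eta> \<longrightarrow> d p q < r" if "r > 0" for r
    proof -
      have r2: "r / 2 > 0" using that by simp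
      obtain \<eta>1 where 1: "\<eta>1 > 0" "\<forall>p\<in>K. \<forall>q\<in>K. dist p q < \<eta>1 \<longrightarrow> \<bar>p m - q m\<bar> < r / 2"
        using coordinate_near[OF r2] by blast
      obtain \<eta>2 where 2: "\<eta>2 > 0" "\<forall>p\<in>K. \<forall>q\<in>K. dist p q < \<eta>2 \<longrightarrow> \<bar>p n - q n\<bar> < r / 2"
        using coordinate_near[OF r2] by blast
      show ?thesis unfolding d_def using 1 2 by (intro exI[of _ "min \<eta>1 \<eta>2"]) fastforce
    qed
    show "d p q \<le> 2" if "p \<in> K" "q \<in> K" for p q
      using K_bounds[OF that(1), of m] K_bounds[OF that(1), of n] K_bounds[OF that(2), of m] K_bounds[OF that(2), of n]
      unfolding d_def by linarith
  qed (auto simp: d_def)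
  from C_relD[OF C this, of "1/2"] obtain k a b where k: "k \<ge> 1" and ab: "\<And>j. j \<in> {1..k} \<Longrightarrow> (a j, b j) \<in> fbar f"
    and small: "d (e x) (\<kappa> (a 1)) < 1/2" "d (\<kappa> (b k)) (e y) < 1/2"
      "\<And>j. j \<in> {1..<k} \<Longrightarrow> d (\<kappa> (b j)) (\<kappa> (a (Suc j))) < 1/2"
    by (simp only: \<kappa>_i) (metis half_gt_zero_iff zero_less_one)
  have "\<kappa> (b j) n = 0" if "1 \<le> j" "j \<le> k" for j
    using that
  proof (induction j rule: dec_induct)
    case base
    have "\<kappa> (a 1) m < 1" using small(1) xy(1) by (auto simp: d_def e_def abs_real_def split: if_splits)
    then show ?case using fP[of "a 1" "b 1"] ab k by simp
  next
    case (step j)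
    have "(a j, b j) \<in> fbar f" using ab step by simp
    then have "b j \<in> Y" using fbar_sub by blast
    then have "\<kappa> (b j) m \<le> 0" using leK[of "\<kappa> (b j)"] step by simp
    moreover have "d (\<kappa> (b j)) (\<kappa> (a (Suc j))) < 1/2" using small(3) step by simp
    ultimately have "\<kappa> (a (Suc j)) m < 1" unfolding d_def by linarith
    then show ?case using fP[of "a (Suc j)" "b (Suc j)"] ab step by simp
  qed
  then have "\<kappa> (b k) n = 0" using k by simp
  then show False using small(2) xy(2) unfolding d_def e_def by linarith
qed

section \<open>Extension of maps to the compactification\<close>

lemma extension:
  assumes "\<And>n. \<exists>m. \<phi> m = \<phi> n \<circ> g"
  obtains G where "continuous_on UNIV G" "\<And>x. G (e x) = e (g x)" "G ` K \<subseteq> K"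
proof -
  obtain \<sigma> where \<sigma>: "\<And>n. \<phi> (\<sigma> n) = \<phi> n \<circ> g" using assms by metis
  \<comment> \<open>Closure of the family under composition with \<open>g\<close> makes the
    extension a mere reindexing of coordinates, continuous on the whole product.\<close>
  define G where "G = (\<lambda>p::nat \<Rightarrow> real. \<lambda>n. p (\<sigma> n))"
  have cont: "continuous_on UNIV G"
    unfolding G_def by (intro continuous_on_coordinatewise_then_product continuous_on_product_coordinates)
  have Ge: "G (e x) = e (g x)" for x unfolding G_def e_def by (simp add: \<sigma>)
  have "G ` closure (range e) \<subseteq> K"
  proof (rule image_closure_subset)
    show "continuous_on (closure (range e)) G" using cont by (rule continuous_on_subset) simp
    show "closed K" by (simp add: K_def)
    show "G ` range e \<subseteq> K" using Ge by auto
  qed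
  then have "G ` K \<subseteq> K" by (simp add: K_def)
  then show ?thesis using that cont Ge by blast
qed

text \<open>The graph of \<open>G\<close> over \<open>K\<close> is compact, hence closed, and the
  image of the graph of \<open>g\<close> is dense in it; so the closure acquires no second value
  over any point.\<close>

lemma fbar_graph:
  assumes "continuous_on UNIV G" "\<And>x. G (e x) = e (g x)" "G ` K \<subseteq> K"
  shows "fbar (graph_on UNIV g) = graph_on Y (\<lambda>u. \<iota> (G (\<kappa> u)))" "continuous_map Z Z (\<lambda>u. \<iota> (G (\<kappa> u)))"
proof -
  have cont: "continuous_on K (\<lambda>p. (p, G p))"
    by (intro continuous_on_Pair continuous_on_id continuous_on_subset[OF assms(1)]) simp
  have im: "map_prod e e ` graph_on UNIV g = (\<lambda>p. (p, G p)) ` range e"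
    by (auto simp: graph_on_def assms(2) image_iff)
  have "closure (map_prod e e ` graph_on UNIV g) = (\<lambda>p. (p, G p)) ` K"
  proof
    have "closed ((\<lambda>p. (p, G p)) ` K)"
      using compact_continuous_image[OF cont compact_K] compact_imp_closed by blast
    then show "closure (map_prod e e ` graph_on UNIV g) \<subseteq> (\<lambda>p. (p, G p)) ` K"
      unfolding im by (intro closure_minimal) auto
    have "(\<lambda>p. (p, G p)) ` closure (range e) \<subseteq> closure (map_prod e e ` graph_on UNIV g)"
      unfolding im using cont[unfolded K_def] closed_closure closure_subset by (rule image_closure_subset)
    then show "(\<lambda>p. (p, G p)) ` K \<subseteq> closure (map_prod e e ` graph_on UNIV g)" by (simp add: K_def)
  qed
  then show "fbar (graph_on UNIV g) = graph_on Y (\<lambda>u. \<iota> (G (\<kappa> u)))"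
    unfolding fbar_eq by (auto simp: graph_on_def Y_def image_image)
  have "continuous_map (top_of_set K) (top_of_set K) G"
    using continuous_on_subset[OF assms(1), of K] assms(3) by (auto simp: continuous_map_in_subtopology)
  from continuous_map_compose[OF continuous_map_compose[OF continuous_map_\<kappa> this]
      homeomorphic_imp_continuous_map[OF homeomorphic_map_\<iota>]]
  show "continuous_map Z Z (\<lambda>u. \<iota> (G (\<kappa> u)))" by (simp add: o_def)
qed

lemma continuous_rel_fbar:
  assumes "\<And>n. \<exists>m. \<phi> m = \<phi> n \<circ> g"
  shows "continuous_rel_in Z (fbar (graph_on UNIV g))"
proof -
  obtain G where G: "continuous_on UNIV G" "\<And>x. G (e x) = e (g x)" "G ` K \<subseteq> K"
    using extension[OF assms] by blast
  show ?thesis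
    unfolding continuous_rel_in_def topspace_Z using fbar_graph[OF G] by blast
qed

text \<open>The extensions of \<open>g\<close> and \<open>inv g\<close> are mutually inverse on the
  dense image of \<open>X\<close>, hence on \<open>K\<close>.\<close>

lemma homeomorphism_rel_fbar:
  assumes "\<And>n. \<exists>m. \<phi> m = \<phi> n \<circ> g" "\<And>n. \<exists>m. \<phi> m = \<phi> n \<circ> inv g" "bij g"
  shows "homeomorphism_rel_in Z (fbar (graph_on UNIV g))"
proof -
  obtain G where G: "continuous_on UNIV G" "\<And>x. G (e x) = e (g x)" "G ` K \<subseteq> K"
    using extension[OF assms(1)] by blast
  obtain H where H: "continuous_on UNIV H" "\<And>x. H (e x) = e (inv g x)" "H ` K \<subseteq> K"
    using extension[OF assms(2)] by blast
  have closed_id: "closed {p. f1 (f2 p) = p}" if "continuous_on UNIV f1" "continuous_on UNIV f2"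
    for f1 f2 :: "(nat \<Rightarrow> real) \<Rightarrow> nat \<Rightarrow> real"
    by (intro closed_Collect_eq continuous_on_compose2[OF that(1) that(2)] continuous_on_id) auto
  have GH: "G (H p) = p" if "p \<in> K" for p
    using K_induct[OF that closed_id[OF G(1) H(1)]] G(2) H(2) assms(3) by (simp add: bij_is_surj surj_f_inv_f)
  have HG: "H (G p) = p" if "p \<in> K" for p
    using K_induct[OF that closed_id[OF H(1) G(1)]] G(2) H(2) assms(3) by (simp add: bij_is_inj)
  have "homeomorphic_maps Z Z (\<lambda>u. \<iota> (G (\<kappa> u))) (\<lambda>u. \<iota> (H (\<kappa> u)))"
    unfolding homeomorphic_maps_def
  proof (intro conjI ballI)
    show "continuous_map Z Z (\<lambda>u. \<iota> (G (\<kappa> u)))" using fbar_graph(2)[OF G] .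
    show "continuous_map Z Z (\<lambda>u. \<iota> (H (\<kappa> u)))" using fbar_graph(2)[OF H] .
    fix u assume "u \<in> topspace Z"
    then have u: "u \<in> Y" by simp
    then have "G (\<kappa> u) \<in> K" "H (\<kappa> u) \<in> K" using G(3) H(3) \<kappa>_in by blast+
    then show "\<iota> (H (\<kappa> (\<iota> (G (\<kappa> u))))) = u" "\<iota> (G (\<kappa> (\<iota> (H (\<kappa> u))))) = u"
      using u GH HG by simp_all
  qed
  then show ?thesis
    unfolding homeomorphism_rel_in_def topspace_Z homeomorphic_map_maps using fbar_graph(1)[OF G] by blast
qed

end

section \<open>Choice of the family\<close>

text \<open>Finite words over \<open>H\<close> keep the family countable. In the left fold a letter
  appended at the end is composed on the right, as the closure property requires.\<close>

lemma countable_composition_closure: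
  fixes \<Phi> :: "('a \<Rightarrow> 'b) set" and H :: "('a \<Rightarrow> 'a) set"
  assumes "countable \<Phi>" "countable H"
    and base: "\<And>\<phi>. \<phi> \<in> \<Phi> \<Longrightarrow> P \<phi>" and step: "\<And>\<psi> h. P \<psi> \<Longrightarrow> h \<in> H \<Longrightarrow> P (\<psi> \<circ> h)"
  obtains \<Psi> where "\<Phi> \<subseteq> \<Psi>" "countable \<Psi>" "\<And>\<psi>. \<psi> \<in> \<Psi> \<Longrightarrow> P \<psi>"
    "\<And>\<psi> h. \<psi> \<in> \<Psi> \<Longrightarrow> h \<in> H \<Longrightarrow> \<psi> \<circ> h \<in> \<Psi>"
proof
  define F where "F = (\<lambda>(\<phi>, hs). foldl (\<circ>) \<phi> hs :: 'a \<Rightarrow> 'b)"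
  define \<Psi> where "\<Psi> = F ` (\<Phi> \<times> lists H)"
  show "countable \<Psi>" unfolding \<Psi>_def using assms by (intro countable_image countable_SIGMA countable_lists)
  show "\<Phi> \<subseteq> \<Psi>"
  proof
    fix \<phi> assume "\<phi> \<in> \<Phi>"
    then show "\<phi> \<in> \<Psi>" unfolding \<Psi>_def by (intro image_eqI[of _ _ "(\<phi>, [])"]) (auto simp: F_def)
  qed
  show "\<psi> \<circ> h \<in> \<Psi>" if \<psi>: "\<psi> \<in> \<Psi>" and h: "h \<in> H" for \<psi> h
  proof -
    obtain \<phi> hs where "\<phi> \<in> \<Phi>" "hs \<in> lists H" "\<psi> = F (\<phi>, hs)" using \<psi> unfolding \<Psi>_def by auto
    then show ?thesis unfolding \<Psi>_def using h
      by (intro image_eqI[of _ _ "(\<phi>, hs @ [h])"]) (auto simp: F_def)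
  qed
  have "P (foldl (\<circ>) \<phi> hs)" if "hs \<in> lists H" "P \<phi>" for \<phi> hs
    using that by (induction hs arbitrary: \<phi>) (auto intro: step)
  then show "P \<psi>" if "\<psi> \<in> \<Psi>" for \<psi> using base that by (auto simp: \<Psi>_def F_def)
qed

theorem theorem1p2:
  fixes f :: "('a::{uniform_space, t2_space, second_countable_topology} \<times> 'a) set"
  assumes "closed f"
  shows "\<exists>(T :: ('a \<times> 'a) filter) (Y :: 'a filter set) V i.
     let Z = uniform_topology Y V;
         fbar = prod_topology Z Z closure_of (map_prod i i ` f);
         restr = (\<lambda>R. map_prod i i -` R)
     in
       uniform_structure UNIV T \<and>
       totally_bounded_structure UNIV T \<and>
       uniformity \<le> T \<and>
       uniform_topology UNIV T = euclidean \<and>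
       is_completion T Y V i \<and>
       compact_space Z \<and> Hausdorff_space Z \<and>
       (\<forall>W. uniform_structure Y W \<and> uniform_topology Y W = Z \<longrightarrow> W = V) \<and>
       metrizable_structure Y V \<and>
       restr fbar = f \<and>
       Id \<union> restr (G_rel Z fbar) = Id \<union> A_rel UNIV uniformity f \<and>
       restr (C_rel Y V fbar) = C_rel UNIV uniformity f \<and>
       (cusc f \<longrightarrow> restr (G_rel Z fbar) = A_rel UNIV uniformity f) \<and>
       (uniformly_continuous_rel f \<longrightarrow> continuous_rel_in Z fbar) \<and>
       (uniform_isomorphism_rel f \<longrightarrow> homeomorphism_rel_in Z fbar)"
proof -
  let ?uc = "\<lambda>\<phi> :: 'a \<Rightarrow> real. uniformly_continuous_on UNIV \<phi> \<and> range \<phi> \<subseteq> {0..1}"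

  \<comment> \<open>Each admissible pair excludes the open set \<open>UA\<close> of all
    \<open>(x, y)\<close> with \<open>h x < j y\<close>. By the separation lemma these sets cover
    the complement of \<open>A_rel\<close>, and Lindelof on the second countable product keeps
    countably many.\<close>
  define SA where "SA = {(h, j). ?uc h \<and> ?uc j \<and> (\<forall>z. h z \<le> j z) \<and> (\<forall>(a, b)\<in>f. j b \<le> h a)}"
  define UA where "UA = (\<lambda>(h, j). {r :: 'a \<times> 'a. h (fst r) < (j (snd r) :: real)})"
  have cont: "continuous_on UNIV h" if "?uc h" for h using that uniformly_continuous_imp_continuous by blast
  have cont2: "continuous_on UNIV (\<lambda>r :: 'a \<times> 'a. h (fst r))" "continuous_on UNIV (\<lambda>r :: 'a \<times> 'a. h (snd r))"
    if "?uc h" for h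
    using continuous_on_compose2[OF cont[OF that], of UNIV fst] continuous_on_compose2[OF cont[OF that], of UNIV snd]
    by (simp_all add: continuous_on_fst continuous_on_snd)
  have "\<exists>J. J \<subseteq> SA \<and> countable J \<and> - A_rel UNIV uniformity f \<subseteq> (\<Union>w\<in>J. UA w)"
  proof (rule countable_subfamily_covering[of SA UA "- A_rel UNIV uniformity f"])
    show "open (UA w)" if "w \<in> SA" for w
      using that unfolding SA_def UA_def by (auto intro!: open_Collect_less cont2)
    show "- A_rel UNIV uniformity f \<subseteq> (\<Union>w\<in>SA. UA w)"
    proof (rule subrelI)
      fix x y assume "(x, y) \<in> - A_rel UNIV uniformity f"
      then have "(x, y) \<notin> A_rel UNIV uniformity f" by simp
      then obtain h j where "uniformly_continuous_on UNIV h" "uniformly_continuous_on UNIV j"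
        "\<And>z. h z \<in> {0..1::real}" "\<And>z. j z \<in> {0..1::real}" "\<And>z. h z \<le> j z"
        "\<And>a b. (a, b) \<in> f \<Longrightarrow> j b \<le> h a" "h x < j y"
        by (rule A_rel_separation) (rule that; assumption)
      then have "(h, j) \<in> SA" "(x, y) \<in> UA (h, j)" by (auto simp: SA_def UA_def)
      then show "(x, y) \<in> (\<Union>w\<in>SA. UA w)" by blast
    qed
  qed blast
  then obtain JA where JA: "JA \<subseteq> SA" "countable JA" "- A_rel UNIV uniformity f \<subseteq> (\<Union>w\<in>JA. UA w)" by auto

  define SC where "SC = {(h, j). ?uc h \<and> ?uc j \<and> (\<forall>z. h z \<le> j z) \<and> (\<forall>(a, b)\<in>f. h a < 1 \<longrightarrow> j b = 0)}"
  define UC where "UC = (\<lambda>(h, j). {r :: 'a \<times> 'a. h (fst r) < (1/2 :: real)} \<inter> {r. 1/2 < (j (snd r) :: real)})"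
  have "\<exists>J. J \<subseteq> SC \<and> countable J \<and> - C_rel UNIV uniformity f \<subseteq> (\<Union>w\<in>J. UC w)"
  proof (rule countable_subfamily_covering[of SC UC "- C_rel UNIV uniformity f"])
    show "open (UC w)" if w: "w \<in> SC" for w
    proof -
      obtain h j where hj: "w = (h, j)" "?uc h" "?uc j" using w by (auto simp: SC_def)
      have "open {r :: 'a \<times> 'a. h (fst r) < (1/2 :: real)}" "open {r :: 'a \<times> 'a. (1/2 :: real) < j (snd r)}"
        using cont2[OF hj(2)] cont2[OF hj(3)] by (simp_all add: open_Collect_less continuous_on_const del: less_divide_eq_numeral1 divide_less_eq_numeral1)
      then show ?thesis unfolding UC_def hj(1) by (simp add: open_Int)
    qed
    show "- C_rel UNIV uniformity f \<subseteq> (\<Union>w\<in>SC. UC w)"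
    proof (rule subrelI)
      fix x y assume "(x, y) \<in> - C_rel UNIV uniformity f"
      then have "(x, y) \<notin> C_rel UNIV uniformity f" by simp
      then obtain h j where "uniformly_continuous_on UNIV h" "uniformly_continuous_on UNIV j"
        "\<And>z. h z \<in> {0..1::real}" "\<And>z. j z \<in> {0..1::real}" "\<And>z. h z \<le> j z"
        "\<And>a b. (a, b) \<in> f \<Longrightarrow> h a < 1 \<Longrightarrow> j b = 0" "h x < 1/2" "1/2 < j y"
        by (rule C_rel_separation) (rule that; assumption)
      then have "(h, j) \<in> SC" "(x, y) \<in> UC (h, j)" by (auto simp: SC_def UC_def)
      then show "(x, y) \<in> (\<Union>w\<in>SC. UC w)" by blast
    qed
  qed blast
  then obtain JC where JC: "JC \<subseteq> SC" "countable JC" "- C_rel UNIV uniformity f \<subseteq> (\<Union>w\<in>JC. UC w)" by auto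

  obtain \<B> :: "'a set set" where \<B>: "countable \<B>" "topological_basis \<B>" using ex_countable_basis by blast
  \<comment> \<open>For a basic set \<open>A\<close>, countably many functions that are
    \<open>1\<close> off \<open>A\<close> have sublevel sets below \<open>1/2\<close> covering
    \<open>A\<close>. Over a countable basis these functions generate the topology.\<close>
  define SB where "SB A = {\<phi>. ?uc \<phi> \<and> (\<forall>z. z \<notin> A \<longrightarrow> \<phi> z = 1)}" for A
  have "\<exists>J. J \<subseteq> SB A \<and> countable J \<and> A \<subseteq> (\<Union>\<phi>\<in>J. {z. \<phi> z < 1/2})" if "A \<in> \<B>" for A
  proof (rule countable_subfamily_covering[of "SB A" "\<lambda>\<phi>. {z. \<phi> z < 1/2}" A])
    show "open {z. \<phi> z < 1/2}" if "\<phi> \<in> SB A" for \<phi>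
      by (rule open_Collect_less[OF cont continuous_on_const]) (use that in \<open>simp add: SB_def\<close>)
    show "A \<subseteq> (\<Union>\<phi>\<in>SB A. {z. \<phi> z < 1/2})"
    proof
      fix x assume "x \<in> A"
      moreover have "open A" using \<B>(2) that by (rule topological_basis_open)
      ultimately obtain \<phi> :: "'a \<Rightarrow> real" where "uniformly_continuous_on UNIV \<phi>"
        "\<And>z. \<phi> z \<in> {0..1}" "\<phi> x = 0" "\<And>z. z \<notin> A \<Longrightarrow> \<phi> z = 1"
        using uniform_space_completely_regular[of A x thesis] by blast
      then have "\<phi> \<in> SB A" "\<phi> x < 1/2" by (auto simp: SB_def)
      then show "x \<in> (\<Union>\<phi>\<in>SB A. {z. \<phi> z < 1/2})" by blast
    qed
  qed blast
  then have "\<forall>A\<in>\<B>. \<exists>J. J \<subseteq> SB A \<and> countable J \<and> A \<subseteq> (\<Union>\<phi>\<in>J. {z. \<phi> z < 1/2})" by blast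
  from bchoice[OF this] obtain JB where JB: "\<forall>A\<in>\<B>. JB A \<subseteq> SB A \<and> countable (JB A) \<and> A \<subseteq> (\<Union>\<phi>\<in>JB A. {z. \<phi> z < 1/2})" ..

  \<comment> \<open>The zero function ensures that the family is nonempty, so that it can be
    enumerated by \<open>nat\<close>.\<close>
  define \<Phi> where "\<Phi> = {\<lambda>_. 0} \<union> (fst ` JA \<union> snd ` JA) \<union> (fst ` JC \<union> snd ` JC) \<union> (\<Union>A\<in>\<B>. JB A)"
  have "countable \<Phi>" unfolding \<Phi>_def using JA(2) JC(2) JB \<B>(1)
    by (intro countable_Un countable_image countable_UN) auto
  have \<Phi>_uc: "?uc \<phi>" if "\<phi> \<in> \<Phi>" for \<phi>
  proof -
    consider "\<phi> = (\<lambda>_. 0)" | w where "w \<in> SA" "\<phi> = fst w \<or> \<phi> = snd w" | w where "w \<in> SC" "\<phi> = fst w \<or> \<phi> = snd w"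
      | A where "\<phi> \<in> SB A"
      using \<open>\<phi> \<in> \<Phi>\<close> JA(1) JC(1) JB unfolding \<Phi>_def by blast
    then show ?thesis
      by cases (auto simp: SA_def SC_def SB_def uniformly_continuous_on_const)
  qed

  \<comment> \<open>at most two maps, so that closing the family under composition with them keeps it countable\<close>
  define H where "H = {g. uniformly_continuous_on UNIV g \<and> (graph_on UNIV g = f \<or> graph_on UNIV g = f\<inverse>)}"
  have inj_graph: "g = g'" if "graph_on UNIV g = graph_on UNIV g'" for g g' :: "'a \<Rightarrow> 'a"
    using that by (auto simp: graph_on_def fun_eq_iff image_iff set_eq_iff)
  have "finite H"
  proof -
    have "finite (graph_on UNIV ` H)" by (rule finite_subset[of _ "{f, f\<inverse>}"]) (auto simp: H_def)
    then show ?thesis by (rule finite_imageD) (auto simp: inj_on_def dest: inj_graph)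
  qed
  then have "countable H" by (rule countable_finite)
  have H_uc: "?uc (\<psi> \<circ> h)" if "?uc \<psi>" "h \<in> H" for \<psi> h
  proof -
    have "uniformly_continuous_on UNIV (\<lambda>x. \<psi> (h x))"
      unfolding uniformly_continuous_on_UNIV_real_iff
    proof (intro allI impI)
      fix r :: real assume "r > 0"
      with that(1) have "eventually (\<lambda>(x, y). \<bar>\<psi> x - \<psi> y\<bar> < r) uniformity"
        by (simp add: uniformly_continuous_on_UNIV_real_iff)
      with uniformly_continuous_onD[of UNIV h] that(2)
      show "eventually (\<lambda>(x, y). \<bar>\<psi> (h x) - \<psi> (h y)\<bar> < r) uniformity"
        by (fastforce simp: H_def)
    qed
    then show ?thesis using that(1) by (auto simp: o_def)
  qed
  obtain \<Psi> where \<Psi>: "\<Phi> \<subseteq> \<Psi>" "countable \<Psi>" "\<And>\<psi>. \<psi> \<in> \<Psi> \<Longrightarrow> ?uc \<psi>"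
    "\<And>\<psi> h. \<psi> \<in> \<Psi> \<Longrightarrow> h \<in> H \<Longrightarrow> \<psi> \<circ> h \<in> \<Psi>"
    by (rule countable_composition_closure[where P = ?uc, OF \<open>countable \<Phi>\<close> \<open>countable H\<close> \<Phi>_uc H_uc])
       (assumption | rule that)+
  define \<phi> where "\<phi> = from_nat_into \<Psi>"
  have "\<Psi> \<noteq> {}" using \<Psi>(1) by (auto simp: \<Phi>_def)
  then have range_\<phi>: "range \<phi> = \<Psi>" unfolding \<phi>_def using \<Psi>(2) by (rule range_from_nat_into)
  then have \<phi>_index: "\<exists>n. \<phi> n = \<psi>" if "\<psi> \<in> \<Psi>" for \<psi> using that by (metis imageE)
  interpret coordinate_family \<phi>
  proof
    show "uniformly_continuous_on UNIV (\<phi> n)" "\<phi> n x \<in> {0..1}" for n x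
      using \<Psi>(3) range_\<phi> by blast+
    fix A and x :: 'a assume "open A" "x \<in> A"
    then obtain B where B: "B \<in> \<B>" "x \<in> B" "B \<subseteq> A" by (rule topological_basisE[OF \<B>(2)])
    then obtain \<psi> where \<psi>: "\<psi> \<in> JB B" "\<psi> x < 1/2" using JB by blast
    then have "\<psi> \<in> SB B" using JB B(1) by blast
    then have one: "\<psi> z = 1" if "z \<notin> B" for z using that by (simp add: SB_def)
    have "\<psi> \<in> \<Psi>" using \<psi>(1) B(1) \<Psi>(1) by (auto simp: \<Phi>_def)
    then obtain n where "\<phi> n = \<psi>" using \<phi>_index by blast
    \<comment> \<open>\<open>\<psi> x < 1/2\<close> while \<open>\<psi>\<close> is \<open>1\<close>
      off \<open>B\<close>, so a change of less than \<open>1/2\<close> cannot leave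
      \<open>B\<close>.\<close>
    moreover have "y \<in> A" if "\<bar>\<psi> x - \<psi> y\<bar> < 1/2" for y
      using that \<psi>(2) one[of y] B(3) by (cases "y \<in> B") auto
    ultimately show "\<exists>n. \<exists>\<delta>>0. \<forall>y. \<bar>\<phi> n x - \<phi> n y\<bar> < \<delta> \<longrightarrow> y \<in> A"
      by (intro exI[of _ n] exI[of _ "1/2"]) auto
  qed
  have G: "map_prod i i -` G_rel Z (fbar f) = A_rel UNIV uniformity f"
  proof (rule equalityI; rule subrelI)
    fix x y assume *: "(x, y) \<in> map_prod i i -` G_rel Z (fbar f)"
    show "(x, y) \<in> A_rel UNIV uniformity f"
    proof (rule ccontr)
      assume "(x, y) \<notin> A_rel UNIV uniformity f"
      then obtain h j where hj: "(h, j) \<in> JA" "(x, y) \<in> UA (h, j)" using JA(3) by fastforce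
      have "h \<in> \<Phi>" "j \<in> \<Phi>"
        using imageI[OF hj(1), of fst] imageI[OF hj(1), of snd] by (simp_all add: \<Phi>_def)
      then have "h \<in> \<Psi>" "j \<in> \<Psi>" using \<Psi>(1) by auto
      from \<phi>_index[OF this(1)] \<phi>_index[OF this(2)] obtain m n where "\<phi> m = h" "\<phi> n = j" by auto
      moreover have "(h, j) \<in> SA" using hj(1) JA(1) by blast
      ultimately have "(i x, i y) \<notin> G_rel Z (fbar f)"
        using hj(2) by (intro G_rel_excluded[of m n]) (auto simp: SA_def UA_def)
      then show False using * by simp
    qed
  next
    fix x y assume "(x, y) \<in> A_rel UNIV uniformity f"
    then show "(x, y) \<in> map_prod i i -` G_rel Z (fbar f)"
      using A_rel_i A_rel_subset_G_rel[OF fbar_sub] by (simp add: subset_iff)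
  qed
  have C: "map_prod i i -` C_rel Y V (fbar f) = C_rel UNIV uniformity f"
  proof (rule equalityI; rule subrelI)
    fix x y assume *: "(x, y) \<in> map_prod i i -` C_rel Y V (fbar f)"
    show "(x, y) \<in> C_rel UNIV uniformity f"
    proof (rule ccontr)
      assume "(x, y) \<notin> C_rel UNIV uniformity f"
      then obtain h j where hj: "(h, j) \<in> JC" "(x, y) \<in> UC (h, j)" using JC(3) by fastforce
      have "h \<in> \<Phi>" "j \<in> \<Phi>"
        using imageI[OF hj(1), of fst] imageI[OF hj(1), of snd] by (simp_all add: \<Phi>_def)
      then have "h \<in> \<Psi>" "j \<in> \<Psi>" using \<Psi>(1) by auto
      from \<phi>_index[OF this(1)] \<phi>_index[OF this(2)] obtain m n where "\<phi> m = h" "\<phi> n = j" by auto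
      moreover have "(h, j) \<in> SC" using hj(1) JC(1) by blast
      ultimately have "(i x, i y) \<notin> C_rel Y V (fbar f)"
        using hj(2) by (intro C_rel_excluded[of m n]) (auto simp: SC_def UC_def)
      then show False using * by simp
    qed
  qed (use C_rel_i in auto)
  have \<phi>_closed: "\<exists>m. \<phi> m = \<phi> n \<circ> g" if "g \<in> H" for n g
    using \<phi>_index \<Psi>(4)[OF _ that] range_\<phi> by blast
  have uc: "continuous_rel_in Z (fbar f)" if ucf: "uniformly_continuous_rel f"
  proof -
    obtain g where g: "f = graph_on UNIV g" "uniformly_continuous_on UNIV g"
      using ucf unfolding uniformly_continuous_rel_def by blast
    then have "g \<in> H" by (simp add: H_def)
    then show ?thesis unfolding g(1) by (intro continuous_rel_fbar \<phi>_closed)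
  qed
  have iso: "homeomorphism_rel_in Z (fbar f)" if isof: "uniform_isomorphism_rel f"
  proof -
    obtain g where g: "f = graph_on UNIV g" "bij g" "uniformly_continuous_on UNIV g"
      "uniformly_continuous_on UNIV (inv g)"
      using isof unfolding uniform_isomorphism_rel_def by blast
    have "graph_on UNIV (inv g) = f\<inverse>"
      unfolding g(1) graph_on_def using g(2)
      by (auto simp: image_iff bij_is_surj surj_f_inv_f bij_is_inj)
    then have "g \<in> H" "inv g \<in> H" using g by (simp_all add: H_def)
    then show ?thesis unfolding g(1) by (intro homeomorphism_rel_fbar \<phi>_closed g(2))
  qed
  have uniq: "W = V" if "uniform_structure Y W" "uniform_topology Y W = Z" for W
    using compact_uniformity_unique[OF uniform_structure_V that compact_space_Z] .
  show ?thesis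
    by (rule exI[of _ T], rule exI[of _ Y], rule exI[of _ V], rule exI[of _ i],
        unfold Let_def fbar_def[symmetric])
       (use uniform_structure_T totally_bounded_T uniformity_le_T uniform_topology_T is_completion_i
         compact_space_Z Hausdorff_space_Z uniq metrizable_structure_V fbar_restrict[OF assms] G C uc iso in simp)
qed

end
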